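(* Let $p$ be a prime, let $G$ be a finite $p$-solvable group, let $M$ be a non-normal maximal subgroup of $G$, and suppose $|G:M| = p^{\alpha}$ for some integer $\alpha$. Then: 1) if $F(M/\mathrm{Core}_G M) \neq 1$ and $q \in \pi(F(M/\mathrm{Core}_G M))$, then $G$ has a Sylow $q$-subgroup $Q$ such that $N_G(Q) \subseteq M$; 2) if $F(M/\mathrm{Core}_G M) = 1$, then $N_G(K) \subseteq M$ for some Hall $p'$-subgroup $K$ of $G$.
   Context: All groups are finite. $F(X)$ denotes the Fitting subgroup of a group $X$; $\pi(Y)$ denotes the set of all prime divisors of $|Y|$ for a finite group $Y$; $\mathrm{Core}_G M = \bigcap_{g\in G} M^g$ is the largest normal subgroup of $G$ contained in $M$; $N_G(Q)$ is the normalizer of $Q$ in $G$. A finite group is $p$-solvable if it has a normal series each of whose factors is a $p$-group or a group of order not divisible by $p$. A Hall $p'$-subgroup of $G$ is a subgroup $K$ such that $|K|$ is not divisible by $p$ and $|G:K|$ is a power of $p$. *)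

theory Defs
  imports "HOL-Algebra.Algebra"
begin

definition maximal_subgroup :: "'a set \<Rightarrow> ('a, 'b) monoid_scheme \<Rightarrow> bool"
  where "maximal_subgroup M G \<longleftrightarrow>
    subgroup M G \<and> M \<noteq> carrier G \<and>
    (\<forall>H. subgroup H G \<longrightarrow> M \<subseteq> H \<longrightarrow> H = M \<or> H = carrier G)"

definition normal_core :: "('a, 'b) monoid_scheme \<Rightarrow> 'a set \<Rightarrow> 'a set"
  where "normal_core G M = (\<Inter>g\<in>carrier G. (inv\<^bsub>G\<^esub> g) <#\<^bsub>G\<^esub> M #>\<^bsub>G\<^esub> g)"

definition subgroup_index :: "('a, 'b) monoid_scheme \<Rightarrow> 'a set \<Rightarrow> nat"
  where "subgroup_index G H = card (rcosets\<^bsub>G\<^esub> H)"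

primrec lower_central_series :: "('a, 'b) monoid_scheme \<Rightarrow> nat \<Rightarrow> 'a set"
  where
    "lower_central_series G 0 = carrier G"
  | "lower_central_series G (Suc n) =
      generate G (\<Union>h\<in>lower_central_series G n. \<Union>g\<in>carrier G.
        {h \<otimes>\<^bsub>G\<^esub> g \<otimes>\<^bsub>G\<^esub> (inv\<^bsub>G\<^esub> h) \<otimes>\<^bsub>G\<^esub> (inv\<^bsub>G\<^esub> g)})"

definition nilpotent_group :: "('a, 'b) monoid_scheme \<Rightarrow> bool"
  where "nilpotent_group G \<longleftrightarrow> (\<exists>n. lower_central_series G n = {\<one>\<^bsub>G\<^esub>})"

definition fitting_subgroup :: "('a, 'b) monoid_scheme \<Rightarrow> 'a set"
  where "fitting_subgroup G =
    generate G (\<Union>{N. N \<lhd> G \<and> nilpotent_group (G\<lparr>carrier := N\<rparr>)})"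

(* Only meaningful for finite groups; the trivial group is a p-group. *)
definition finite_p_group :: "nat \<Rightarrow> ('a, 'b) monoid_scheme \<Rightarrow> bool"
  where "finite_p_group p G \<longleftrightarrow> (\<exists>k. order G = p ^ k)"

(* All terms of the series are normal in the whole group G, not just in the next term. *)
definition p_solvable :: "nat \<Rightarrow> ('a, 'b) monoid_scheme \<Rightarrow> bool"
  where "p_solvable p G \<longleftrightarrow>
    (\<exists>n (H :: nat \<Rightarrow> 'a set).
      H 0 = {\<one>\<^bsub>G\<^esub>} \<and> H n = carrier G \<and>
      (\<forall>i\<le>n. H i \<lhd> G) \<and>
      (\<forall>i<n. H i \<subseteq> H (Suc i) \<and>
        (finite_p_group p (G\<lparr>carrier := H (Suc i)\<rparr> Mod H i) \<or>
         \<not> p dvd order (G\<lparr>carrier := H (Suc i)\<rparr> Mod H i))))"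

definition sylow_subgroup :: "nat \<Rightarrow> 'a set \<Rightarrow> ('a, 'b) monoid_scheme \<Rightarrow> bool"
  where "sylow_subgroup q Q G \<longleftrightarrow>
    subgroup Q G \<and> card Q = q ^ multiplicity q (order G)"

definition hall_p'_subgroup :: "nat \<Rightarrow> 'a set \<Rightarrow> ('a, 'b) monoid_scheme \<Rightarrow> bool"
  where "hall_p'_subgroup p K G \<longleftrightarrow>
    subgroup K G \<and> \<not> p dvd card K \<and> (\<exists>k. subgroup_index G K = p ^ k)"

end

theory Submission
  imports Defs
begin

text \<open>Let \<open>C\<close> be the core of \<open>M\<close>. As \<open>G\<close> is \<open>p\<close>-solvable and \<open>|G : M|\<close> is a power of \<open>p\<close>, a minimal
  normal subgroup \<open>L / C\<close> of the primitive group \<open>G / C\<close> is a \<open>p\<close>-group, and \<open>G = L M\<close>,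
  \<open>L \<inter> M = C\<close> (lemma \<open>ex_normal_complement_modulo_core\<close>).

  Let \<open>R\<close> be normal in \<open>M\<close> with \<open>C \<subset> R\<close>, and let \<open>K \<le> M\<close> satisfy \<open>R \<subseteq> K C\<close>. Then
  \<open>N\<^sub>G(K) \<subseteq> M\<close> (lemma \<open>normalizer_subset_maximal\<close>): if \<open>l m\<close> with \<open>l \<in> L\<close> and \<open>m \<in> M\<close> normalizes
  \<open>K\<close>, then \<open>l\<close> conjugates \<open>R\<close> into \<open>M\<close>, so \<open>[R, l] \<subseteq> L \<inter> M = C \<subseteq> R\<close>. Hence \<open>l\<close> normalizes \<open>R\<close>.
  The normalizer of \<open>R\<close> contains \<open>M\<close> but is not \<open>G\<close>, as \<open>R\<close> is not contained in the core. By
  maximality it is \<open>M\<close>, and \<open>l \<in> M\<close>.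

  It remains to choose \<open>R\<close>. If \<open>q\<close> divides the order of the Fitting subgroup of \<open>M / C\<close>, then
  \<open>M / C\<close> has a normal \<open>q\<close>-subgroup \<open>R / C \<noteq> 1\<close> (lemma \<open>fitting_Mod_prime_dvd\<close>). Here \<open>q \<noteq> p\<close>,
  because normalizers grow in the \<open>p\<close>-group \<open>R L / C\<close> if \<open>q = p\<close> (lemma \<open>no_normal_p_section\<close>).
  So a Sylow \<open>q\<close>-subgroup \<open>K\<close> of \<open>M\<close> is one of \<open>G\<close>, and \<open>R \<subseteq> K C\<close>. If the Fitting subgroup of
  \<open>M / C\<close> is trivial, a minimal normal subgroup \<open>R / C\<close> of \<open>M / C\<close> is not an (abelian) \<open>p\<close>-group and
  so has order prime to \<open>p\<close>; it lies in \<open>K C / C\<close> for every Hall \<open>p'\<close>-subgroup \<open>K\<close> of \<open>M\<close>, and \<open>K\<close>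
  is also a Hall \<open>p'\<close>-subgroup of \<open>G\<close>. Such a \<open>K\<close> exists by the abelian case of the
  Schur-Zassenhaus theorem (lemmas \<open>abelian_normal_complement\<close> and \<open>ex_hall_p'_subgroup\<close>).\<close>

section \<open>Subgroups and orders in a finite group\<close>

text \<open>All groups that occur are sections \<open>A / C\<close> of one ambient finite group. They are mostly
  handled through the subgroups \<open>A\<close> and \<open>C\<close>: ``\<open>A / C\<close> has order \<open>n\<close>'' is written
  \<open>card A = n * card C\<close>, and normality is replaced by the following relation between subsets.\<close>
definition normalizes :: "('a, 'b) monoid_scheme \<Rightarrow> 'a set \<Rightarrow> 'a set \<Rightarrow> bool"
  where "normalizes G M R \<longleftrightarrow> (\<forall>m\<in>M. \<forall>r\<in>R. m \<otimes>\<^bsub>G\<^esub> r \<otimes>\<^bsub>G\<^esub> inv\<^bsub>G\<^esub> m \<in> R)"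

lemma normalizesD: "normalizes G M R \<Longrightarrow> m \<in> M \<Longrightarrow> r \<in> R \<Longrightarrow> m \<otimes>\<^bsub>G\<^esub> r \<otimes>\<^bsub>G\<^esub> inv\<^bsub>G\<^esub> m \<in> R"
  by (simp add: normalizes_def)

lemma normalizes_mono: "normalizes G M R \<Longrightarrow> M' \<subseteq> M \<Longrightarrow> normalizes G M' R"
  by (auto simp: normalizes_def)

lemma normalizes_Int: "normalizes G M R \<Longrightarrow> normalizes G M S \<Longrightarrow> normalizes G M (R \<inter> S)"
  by (auto simp: normalizes_def)

context group
begin

lemma inv_mult_cancel: "x \<in> carrier G \<Longrightarrow> y \<in> carrier G \<Longrightarrow> inv x \<otimes> (x \<otimes> y) = y"
  by (simp add: m_assoc[symmetric])

lemma mult_inv_cancel: "x \<in> carrier G \<Longrightarrow> y \<in> carrier G \<Longrightarrow> x \<otimes> (inv x \<otimes> y) = y"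
  by (simp add: m_assoc[symmetric])

text \<open>Together with the default rules these equations decide equality of group words.\<close>
lemmas group_word = m_assoc inv_mult_group inv_mult_cancel mult_inv_cancel

lemma normalizes_self: "subgroup H G \<Longrightarrow> normalizes G H H"
  by (auto simp: normalizes_def subgroup.m_closed subgroup.m_inv_closed)

lemma normal_iff_normalizes: "N \<lhd> G \<longleftrightarrow> subgroup N G \<and> normalizes G (carrier G) N"
  by (auto simp: normal_inv_iff normalizes_def)

lemma normal_restrict_iff:
  assumes H: "subgroup H G" and N: "N \<subseteq> H"
  shows "N \<lhd> G\<lparr>carrier := H\<rparr> \<longleftrightarrow> subgroup N G \<and> normalizes G H N"
proof -
  interpret H: group "G\<lparr>carrier := H\<rparr>" by (rule subgroup_imp_group[OF H])
  have "subgroup N (G\<lparr>carrier := H\<rparr>) \<longleftrightarrow> subgroup N G"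
    using H N incl_subgroup subgroup_incl by blast
  then show ?thesis
    unfolding H.normal_inv_iff normalizes_def by (simp add: m_inv_consistent[OF H])
qed

lemma subgroup_set_mult:
  assumes A: "subgroup A G" and B: "subgroup B G" and AB: "normalizes G A B"
  shows "subgroup (A <#> B) G"
proof (rule subgroupI)
  note [simp] = subgroup.mem_carrier[OF A] subgroup.mem_carrier[OF B]
    subgroup.m_closed[OF A] subgroup.m_closed[OF B]
    subgroup.m_inv_closed[OF A] subgroup.m_inv_closed[OF B]
    subgroup.one_closed[OF A] subgroup.one_closed[OF B]
  show "A <#> B \<subseteq> carrier G" by (auto simp: set_mult_def)
  show "A <#> B \<noteq> {}"
    using subgroup.one_closed[OF A] subgroup.one_closed[OF B] unfolding set_mult_def by blast
  fix x assume "x \<in> A <#> B"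
  then obtain a b where ab: "a \<in> A" "b \<in> B" "x = a \<otimes> b" by (auto simp: set_mult_def)
  have "inv x = inv a \<otimes> (a \<otimes> inv b \<otimes> inv a)" using ab by (simp add: group_word)
  moreover have "a \<otimes> inv b \<otimes> inv a \<in> B" using ab AB by (simp add: normalizesD)
  ultimately show "inv x \<in> A <#> B" using ab(1) unfolding set_mult_def by auto
  fix y assume "y \<in> A <#> B"
  then obtain c d where cd: "c \<in> A" "d \<in> B" "y = c \<otimes> d" by (auto simp: set_mult_def)
  have "inv c \<otimes> b \<otimes> inv (inv c) \<in> B" using ab cd AB by (blast intro: normalizesD subgroup.m_inv_closed[OF A])
  then have "inv c \<otimes> b \<otimes> inv (inv c) \<otimes> d \<in> B" using cd by simp
  moreover have "x \<otimes> y = (a \<otimes> c) \<otimes> (inv c \<otimes> b \<otimes> inv (inv c) \<otimes> d)"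
    using ab cd by (simp add: group_word)
  ultimately show "x \<otimes> y \<in> A <#> B" using ab cd unfolding set_mult_def by auto
qed

lemma subset_set_mult1: "A \<subseteq> carrier G \<Longrightarrow> subgroup B G \<Longrightarrow> A \<subseteq> A <#> B"
  using subgroup.one_closed[of B G] by (force simp: set_mult_def)

lemma subset_set_mult2: "subgroup A G \<Longrightarrow> B \<subseteq> carrier G \<Longrightarrow> B \<subseteq> A <#> B"
  using subgroup.one_closed[of A G] by (force simp: set_mult_def)

lemma set_mult_subset: "subgroup P G \<Longrightarrow> A \<subseteq> P \<Longrightarrow> B \<subseteq> P \<Longrightarrow> A <#> B \<subseteq> P"
  by (auto simp: set_mult_def intro!: subgroup.m_closed)

lemma normalizes_set_mult:
  assumes "M \<subseteq> carrier G" "A \<subseteq> carrier G" "B \<subseteq> carrier G" "normalizes G M A" "normalizes G M B"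
  shows "normalizes G M (A <#> B)"
  unfolding normalizes_def
proof (intro ballI)
  fix m x assume m: "m \<in> M" and "x \<in> A <#> B"
  then obtain a b where ab: "a \<in> A" "b \<in> B" "x = a \<otimes> b" by (auto simp: set_mult_def)
  have [simp]: "m \<in> carrier G" "a \<in> carrier G" "b \<in> carrier G" using m ab assms by auto
  have "m \<otimes> x \<otimes> inv m = (m \<otimes> a \<otimes> inv m) \<otimes> (m \<otimes> b \<otimes> inv m)"
    by (simp add: ab group_word)
  moreover have "m \<otimes> a \<otimes> inv m \<in> A" "m \<otimes> b \<otimes> inv m \<in> B" using m ab assms by (auto simp: normalizesD)
  ultimately show "m \<otimes> x \<otimes> inv m \<in> A <#> B" unfolding set_mult_def by auto
qed

lemma subgroup_conj:
  assumes H: "subgroup H G" and x: "x \<in> carrier G"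
  shows "subgroup ((\<lambda>h. x \<otimes> h \<otimes> inv x) ` H) G"
proof (rule subgroupI)
  note [simp] = subgroup.mem_carrier[OF H] x
  show "(\<lambda>h. x \<otimes> h \<otimes> inv x) ` H \<subseteq> carrier G" by auto
  show "(\<lambda>h. x \<otimes> h \<otimes> inv x) ` H \<noteq> {}" using subgroup.one_closed[OF H] by blast
  fix a assume "a \<in> (\<lambda>h. x \<otimes> h \<otimes> inv x) ` H"
  then obtain h where h: "h \<in> H" "a = x \<otimes> h \<otimes> inv x" by blast
  have "inv a = x \<otimes> inv h \<otimes> inv x" using h by (simp add: group_word)
  then show "inv a \<in> (\<lambda>h. x \<otimes> h \<otimes> inv x) ` H" using h subgroup.m_inv_closed[OF H] by blast
  fix b assume "b \<in> (\<lambda>h. x \<otimes> h \<otimes> inv x) ` H"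
  then obtain k where k: "k \<in> H" "b = x \<otimes> k \<otimes> inv x" by blast
  have "a \<otimes> b = x \<otimes> (h \<otimes> k) \<otimes> inv x" using h k by (simp add: group_word)
  then show "a \<otimes> b \<in> (\<lambda>h. x \<otimes> h \<otimes> inv x) ` H" using h k subgroup.m_closed[OF H] by blast
qed

lemma card_conj:
  assumes "H \<subseteq> carrier G" and x: "x \<in> carrier G"
  shows "card ((\<lambda>h. x \<otimes> h \<otimes> inv x) ` H) = card H"
proof (rule card_image, rule inj_onI)
  fix h k assume "h \<in> H" "k \<in> H" "x \<otimes> h \<otimes> inv x = x \<otimes> k \<otimes> inv x"
  then show "h = k" using assms by (metis l_cancel r_cancel inv_closed m_closed subsetD)
qed

end

locale finite_group = group +
  assumes finite_carrier: "finite (carrier G)"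
begin

lemma subgroup_finite: "subgroup H G \<Longrightarrow> finite H"
  using finite_carrier subgroup.subset by (metis finite_subset)

lemma subgroup_card_pos: "subgroup H G \<Longrightarrow> 0 < card H"
  using subgroup_finite subgroup.one_closed by (metis card_gt_0_iff empty_iff)

lemma finite_group_subgroup: "subgroup H G \<Longrightarrow> finite_group (G\<lparr>carrier := H\<rparr>)"
  using subgroup_imp_group subgroup_finite
  by (simp add: finite_group_def finite_group_axioms_def)

lemma finite_group_Mod: "N \<lhd> G \<Longrightarrow> finite_group (G Mod N)"
  by (simp add: finite_group_def finite_group_axioms_def normal.factorgroup_is_group
      carrier_FactGroup finite_carrier)

lemma subgroup_card_dvd:
  assumes A: "subgroup A G" and B: "subgroup B G" and AB: "A \<subseteq> B"
  shows "card A dvd card B"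
proof -
  interpret B: group "G\<lparr>carrier := B\<rparr>" by (rule subgroup_imp_group[OF B])
  have "card (rcosets\<^bsub>G\<lparr>carrier := B\<rparr>\<^esub> A) * card A = order (G\<lparr>carrier := B\<rparr>)"
    by (rule B.lagrange[OF subgroup_incl[OF A B AB]])
  then show ?thesis by (metis dvd_triv_right order_def partial_object.select_convs(1)
      partial_object.update_convs(1) partial_object.surjective)
qed

lemma subgroup_card_dvd_order: "subgroup A G \<Longrightarrow> card A dvd order G"
  using subgroup_card_dvd[OF _ subgroup_self] subgroup.subset unfolding order_def by blast

lemma subgroup_index_mult: "subgroup H G \<Longrightarrow> order G = subgroup_index G H * card H"
  unfolding subgroup_index_def by (simp add: lagrange)

lemma order_Mod:
  assumes A: "subgroup A G" and C: "subgroup C G" and CA: "C \<subseteq> A"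
  shows "card (rcosets\<^bsub>G\<lparr>carrier := A\<rparr>\<^esub> C) * card C = card A"
proof -
  interpret A: group "G\<lparr>carrier := A\<rparr>" by (rule subgroup_imp_group[OF A])
  show ?thesis using A.lagrange[OF subgroup_incl[OF C A CA]] by (simp add: order_def)
qed

text \<open>The multiplication map \<open>A \<times> B \<rightarrow> A B\<close> has all its fibres in bijection with \<open>A \<inter> B\<close>.\<close>
lemma card_set_mult:
  assumes A: "subgroup A G" and B: "subgroup B G"
  shows "card (A <#> B) * card (A \<inter> B) = card A * card B"
proof -
  note [simp] = subgroup.mem_carrier[OF A] subgroup.mem_carrier[OF B]
    subgroup.m_closed[OF A] subgroup.m_closed[OF B]
    subgroup.m_inv_closed[OF A] subgroup.m_inv_closed[OF B]
  have fin: "finite A" "finite B" using A B by (simp_all add: subgroup_finite)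
  let ?f = "\<lambda>(a, b). a \<otimes> b"
  have img: "A <#> B = ?f ` (A \<times> B)" by (auto simp: set_mult_def)
  have fibre: "card {z \<in> A \<times> B. ?f z = x} = card (A \<inter> B)" if x: "x \<in> A <#> B" for x
  proof -
    obtain a b where ab: "a \<in> A" "b \<in> B" "x = a \<otimes> b" using x by (auto simp: set_mult_def)
    have "bij_betw (\<lambda>d. (a \<otimes> d, inv d \<otimes> b)) (A \<inter> B) {z \<in> A \<times> B. ?f z = x}"
    proof (rule bij_betw_byWitness[where f' = "\<lambda>z. inv a \<otimes> fst z"])
      show "\<forall>d\<in>A \<inter> B. inv a \<otimes> fst (a \<otimes> d, inv d \<otimes> b) = d" using ab by (simp add: group_word)
      show "\<forall>z\<in>{z \<in> A \<times> B. ?f z = x}. (a \<otimes> (inv a \<otimes> fst z), inv (inv a \<otimes> fst z) \<otimes> b) = z"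
      proof
        fix z assume "z \<in> {z \<in> A \<times> B. ?f z = x}"
        then obtain a' b' where z: "z = (a', b')" and h: "a' \<in> A" "b' \<in> B" "a' \<otimes> b' = x" by auto
        have 1: "a \<otimes> (inv a \<otimes> a') = a'" using h ab by (simp add: group_word)
        have "inv (inv a \<otimes> a') \<otimes> b = inv a' \<otimes> x" using h(1,2) ab by (simp add: group_word)
        also have "\<dots> = b'" unfolding h(3)[symmetric] using h(1,2) by (simp add: group_word)
        finally have "inv (inv a \<otimes> a') \<otimes> b = b'" .
        with 1 z show "(a \<otimes> (inv a \<otimes> fst z), inv (inv a \<otimes> fst z) \<otimes> b) = z" by simp
      qed
      show "(\<lambda>d. (a \<otimes> d, inv d \<otimes> b)) ` (A \<inter> B) \<subseteq> {z \<in> A \<times> B. ?f z = x}"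
        using ab by (auto simp: group_word)
      show "(\<lambda>z. inv a \<otimes> fst z) ` {z \<in> A \<times> B. ?f z = x} \<subseteq> A \<inter> B"
      proof
        fix y assume "y \<in> (\<lambda>z. inv a \<otimes> fst z) ` {z \<in> A \<times> B. ?f z = x}"
        then obtain a' b' where y: "y = inv a \<otimes> a'" and h: "a' \<in> A" "b' \<in> B" "a' \<otimes> b' = x" by auto
        have "inv a \<otimes> a' = b \<otimes> inv b'"
        proof -
          have "inv a \<otimes> a' = inv a \<otimes> (a' \<otimes> b') \<otimes> inv b'" using h(1,2) ab by (simp add: group_word)
          also have "\<dots> = b \<otimes> inv b'" unfolding h(3) using h(1,2) ab by (simp add: group_word)
          finally show ?thesis .
        qed
        moreover have "inv a \<otimes> a' \<in> A" "b \<otimes> inv b' \<in> B" using h ab by simp_all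
        ultimately show "y \<in> A \<inter> B" using y by simp
      qed
    qed
    from bij_betw_same_card[OF this] show ?thesis by (rule sym)
  qed
  have "card A * card B = (\<Sum>z\<in>A \<times> B. 1)" by (simp add: card_cartesian_product)
  also have "\<dots> = (\<Sum>x\<in>?f ` (A \<times> B). \<Sum>z\<in>{z \<in> A \<times> B. ?f z = x}. 1)"
    by (rule sum.image_gen) (simp add: fin)
  also have "\<dots> = (\<Sum>x\<in>A <#> B. card {z \<in> A \<times> B. ?f z = x})" by (simp only: img card_eq_sum)
  also have "\<dots> = card (A <#> B) * card (A \<inter> B)" by (simp add: fibre)
  finally show ?thesis by simp
qed

text \<open>The reason is that \<open>|A B : B| = |A : A \<inter> B|\<close> divides both \<open>u\<close> and \<open>v\<close>. For \<open>C = 1\<close> this covers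
  the following facts: a normal \<open>q\<close>-subgroup lies in every Sylow \<open>q\<close>-subgroup, a normal
  \<open>p'\<close>-subgroup in every Hall \<open>p'\<close>-subgroup, and every \<open>q\<close>-subgroup in a normal Sylow \<open>q\<close>-subgroup.\<close>
lemma subset_of_coprime_index:
  assumes A: "subgroup A G" and B: "subgroup B G" and P: "subgroup P G" and C: "subgroup C G"
    and sub: "A \<subseteq> P" "B \<subseteq> P" "C \<subseteq> A" "C \<subseteq> B"
    and AB: "subgroup (A <#> B) G"
    and cA: "card A = u * card C" and cP: "card P = v * card B" and uv: "coprime u v"
  shows "A \<subseteq> B"
proof -
  have I: "subgroup (A \<inter> B) G" using A B by (rule subgroups_Inter_pair)
  obtain i where i: "card (A \<inter> B) = card C * i"
    using subgroup_card_dvd[OF C I] sub unfolding dvd_def by blast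
  obtain d where d: "card A = card (A \<inter> B) * d"
    using subgroup_card_dvd[OF I A] unfolding dvd_def by blast
  obtain e where e: "card (A <#> B) = card B * e"
    using subgroup_card_dvd[OF B AB] subset_set_mult2[OF A] subgroup.subset[OF B] unfolding dvd_def by blast
  obtain f where f: "card P = card (A <#> B) * f"
    using subgroup_card_dvd[OF AB P] set_mult_subset[OF P] sub unfolding dvd_def by blast
  note pos = subgroup_card_pos[OF C] subgroup_card_pos[OF I] subgroup_card_pos[OF B]
  have "u = i * d" using cA pos(1) unfolding d i by (simp add: mult.assoc mult.commute)
  moreover have "card B * e * card (A \<inter> B) = card (A \<inter> B) * d * card B"
    using card_set_mult[OF A B] e d by simp
  then have "e = d" using pos by simp
  moreover have "v = e * f" using cP pos(3) unfolding f e by (simp add: mult.assoc mult.commute)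
  ultimately have "coprime d d" using uv by simp
  then have "d = 1" by simp
  then have "A \<inter> B = A" using d subgroup_finite[OF A] by (metis card_subset_eq inf_le1 mult.right_neutral)
  then show ?thesis by blast
qed

text \<open>The normalizer of a subgroup \<open>H\<close>, defined through the inclusion \<open>x H x\<inverse> \<subseteq> H\<close> only.\<close>
definition normalizer_set :: "'a set \<Rightarrow> 'a set"
  where "normalizer_set H = {x \<in> carrier G. normalizes G {x} H}"

text \<open>By finiteness \<open>x H x\<inverse> \<subseteq> H\<close> implies \<open>x H x\<inverse> = H\<close>, which gives closure under inverses.\<close>
lemma subgroup_normalizer_set:
  assumes H: "subgroup H G"
  shows "subgroup (normalizer_set H) G"
proof (rule subgroupI)
  note [simp] = subgroup.mem_carrier[OF H]
  show "normalizer_set H \<subseteq> carrier G" by (auto simp: normalizer_set_def)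
  show "normalizer_set H \<noteq> {}" by (auto simp: normalizer_set_def normalizes_def intro!: exI[of _ \<one>])
  fix x assume x: "x \<in> normalizer_set H"
  then have xc [simp]: "x \<in> carrier G" and xH: "\<And>h. h \<in> H \<Longrightarrow> x \<otimes> h \<otimes> inv x \<in> H"
    by (auto simp: normalizer_set_def normalizes_def)
  have onto: "(\<lambda>h. x \<otimes> h \<otimes> inv x) ` H = H"
    using card_conj[OF subgroup.subset[OF H] xc] xH subgroup_finite[OF H]
    by (intro card_subset_eq) auto
  have "inv x \<otimes> h \<otimes> inv (inv x) \<in> H" if "h \<in> H" for h
  proof -
    obtain k where "k \<in> H" "h = x \<otimes> k \<otimes> inv x" using onto \<open>h \<in> H\<close> by blast
    then show ?thesis by (simp add: group_word)
  qed
  then show "inv x \<in> normalizer_set H" by (auto simp: normalizer_set_def normalizes_def)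
  fix y assume y: "y \<in> normalizer_set H"
  have "x \<otimes> y \<otimes> h \<otimes> inv (x \<otimes> y) \<in> H" if h: "h \<in> H" for h
  proof -
    have yc: "y \<in> carrier G" and "y \<otimes> h \<otimes> inv y \<in> H"
      using y h by (auto simp: normalizer_set_def normalizes_def)
    from xH[OF this(2)] show ?thesis using h yc by (simp add: group_word)
  qed
  then show "x \<otimes> y \<in> normalizer_set H" using y by (auto simp: normalizer_set_def normalizes_def)
qed

lemma normalizes_iff_subset: "M \<subseteq> carrier G \<Longrightarrow> normalizes G M H \<longleftrightarrow> M \<subseteq> normalizer_set H"
  by (auto simp: normalizer_set_def normalizes_def)

end

section \<open>Fixed points of p-groups\<close>

context group
begin

lemma group_actionI:
  assumes closed: "\<And>g x. g \<in> carrier G \<Longrightarrow> x \<in> E \<Longrightarrow> f g x \<in> E"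
    and one: "\<And>x. x \<in> E \<Longrightarrow> f \<one> x = x"
    and mult: "\<And>g h x. g \<in> carrier G \<Longrightarrow> h \<in> carrier G \<Longrightarrow> x \<in> E \<Longrightarrow> f (g \<otimes> h) x = f g (f h x)"
  shows "group_action G E (\<lambda>g. \<lambda>x\<in>E. f g x)"
proof -
  have inv: "f (inv g) (f g x) = x" "f g (f (inv g) x) = x" if "g \<in> carrier G" "x \<in> E" for g x
    using mult[of "inv g" g x] mult[of g "inv g" x] one that by simp_all
  have bij: "(\<lambda>x\<in>E. f g x) \<in> Bij E" if g: "g \<in> carrier G" for g
  proof -
    have "bij_betw (f g) E E"
      by (rule bij_betw_byWitness[where f' = "f (inv g)"]) (use inv closed g in auto)
    then show ?thesis by (simp add: Bij_def)
  qed
  have "(\<lambda>g. \<lambda>x\<in>E. f g x) \<in> hom G (BijGroup E)"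
    by (rule homI) (auto simp: BijGroup_def bij mult compose_def closed intro!: restrict_ext)
  then show ?thesis
    by (simp add: group_action_def group_hom_def group_hom_axioms_def group_BijGroup is_group)
qed

end

lemma dvd_prime_power_cases:
  fixes p d :: nat
  assumes "Factorial_Ring.prime p" "d dvd p ^ k"
  obtains "d = 1" | "p dvd d"
proof -
  obtain i where "d = p ^ i" using assms divides_primepow_nat by blast
  then show thesis using that by (cases i) auto
qed

text \<open>An orbit with more than one point has size divisible by \<open>p\<close> as soon as the acting group
  is a \<open>p\<close>-group modulo a subgroup acting trivially.\<close>
lemma (in group_action) prime_dvd_card_moved_points:
  assumes p: "Factorial_Ring.prime p" and fin: "finite (carrier G)" "finite E"
    and C: "subgroup C G" and ord: "order G = p ^ k * card C"
    and triv: "\<And>g x. g \<in> C \<Longrightarrow> x \<in> E \<Longrightarrow> \<phi> g x = x"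
  shows "p dvd card {x \<in> E. \<exists>g\<in>carrier G. \<phi> g x \<noteq> x}"
proof -
  interpret G: finite_group G
    using fin group_hom by (simp add: finite_group_def finite_group_axioms_def group_hom_def)
  let ?O = "{orbit G \<phi> x | x. x \<in> E \<and> (\<exists>g\<in>carrier G. \<phi> g x \<noteq> x)}"
  have orb: "orbit G \<phi> x \<in> orbits G E \<phi>" if "x \<in> E" for x using that by (auto simp: orbits_def)
  have orbE: "orbit G \<phi> x \<subseteq> E" if "x \<in> E" for x
    using orb[OF that] orbits_coverture by blast
  have eq: "{x \<in> E. \<exists>g\<in>carrier G. \<phi> g x \<noteq> x} = \<Union>?O"
  proof
    show "{x \<in> E. \<exists>g\<in>carrier G. \<phi> g x \<noteq> x} \<subseteq> \<Union>?O" using orbit_refl by blast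
    show "\<Union>?O \<subseteq> {x \<in> E. \<exists>g\<in>carrier G. \<phi> g x \<noteq> x}"
    proof
      fix y assume "y \<in> \<Union>?O"
      then obtain x g where x: "x \<in> E" "g \<in> carrier G" "\<phi> g x \<noteq> x" and y: "y \<in> orbit G \<phi> x" by blast
      then have yE: "y \<in> E" using orbE by blast
      have "\<exists>h\<in>carrier G. \<phi> h y \<noteq> y"
      proof (rule ccontr)
        assume "\<not> ?thesis"
        then have "orbit G \<phi> y \<subseteq> {y}" by (auto simp: orbit_def)
        moreover have "x \<in> orbit G \<phi> y" by (rule orbit_sym[OF x(1) yE y])
        ultimately have "x = y" by blast
        with \<open>\<not> ?thesis\<close> x show False by blast
      qed
      with yE show "y \<in> {x \<in> E. \<exists>g\<in>carrier G. \<phi> g x \<noteq> x}" by blast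
    qed
  qed
  have "p dvd card (\<Union>?O)"
  proof (rule dvd_partition)
    show "finite (\<Union>?O)" unfolding eq[symmetric] using fin by simp
    show "\<forall>c1\<in>?O. \<forall>c2\<in>?O. c1 \<noteq> c2 \<longrightarrow> c1 \<inter> c2 = {}"
    proof (intro ballI impI)
      fix c d assume "c \<in> ?O" "d \<in> ?O" "c \<noteq> d"
      then show "c \<inter> d = {}" using disjoint_union[of c d] orb by blast
    qed
    show "\<forall>c\<in>?O. p dvd card c"
    proof
      fix c assume "c \<in> ?O"
      then obtain x g where x: "x \<in> E" "g \<in> carrier G" "\<phi> g x \<noteq> x" and c: "c = orbit G \<phi> x" by blast
      let ?S = "stabilizer G \<phi> x"
      have S: "subgroup ?S G" by (rule stabilizer_subgroup[OF x(1)])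
      have "C \<subseteq> ?S" using triv x subgroup.mem_carrier[OF C] by (auto simp: stabilizer_def)
      then obtain s where s: "card ?S = card C * s"
        using G.subgroup_card_dvd[OF C S] by (blast elim: dvdE)
      have "card c * (card C * s) = p ^ k * card C"
        using orbit_stabilizer_theorem[OF x(1)] ord s c by simp
      then have "card c * s = p ^ k" using G.subgroup_card_pos[OF C] by simp
      then have "card c dvd p ^ k" by (metis dvd_triv_left)
      moreover have "card c \<noteq> 1"
      proof
        assume "card c = 1"
        then obtain z where "c = {z}" by (auto simp: card_1_singleton_iff)
        moreover have "x \<in> c" "\<phi> g x \<in> c" using orbit_refl[OF x(1)] x(2) c by (auto simp: orbit_def)
        ultimately show False using x(3) by simp
      qed
      ultimately show "p dvd card c" using dvd_prime_power_cases[OF p] by metis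
    qed
  qed
  then show ?thesis using eq by simp
qed

lemma (in group_action) ex_other_fixed_point:
  assumes p: "Factorial_Ring.prime p" and fin: "finite (carrier G)" "finite E"
    and C: "subgroup C G" and ord: "order G = p ^ k * card C"
    and triv: "\<And>g x. g \<in> C \<Longrightarrow> x \<in> E \<Longrightarrow> \<phi> g x = x"
    and dvd: "p dvd card E" and y: "y \<in> E" "\<And>g. g \<in> carrier G \<Longrightarrow> \<phi> g y = y"
  obtains x where "x \<in> E" "x \<noteq> y" "\<And>g. g \<in> carrier G \<Longrightarrow> \<phi> g x = x"
proof (rule ccontr)
  assume "\<not> thesis"
  then have "E = insert y {x \<in> E. \<exists>g\<in>carrier G. \<phi> g x \<noteq> x}" using y that by blast
  moreover have "y \<notin> {x \<in> E. \<exists>g\<in>carrier G. \<phi> g x \<noteq> x}" using y by blast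
  ultimately have "card E = card {x \<in> E. \<exists>g\<in>carrier G. \<phi> g x \<noteq> x} + 1"
    using card_insert_disjoint[of "{x \<in> E. \<exists>g\<in>carrier G. \<phi> g x \<noteq> x}" y] fin by simp
  moreover have "p dvd card {x \<in> E. \<exists>g\<in>carrier G. \<phi> g x \<noteq> x}"
    using prime_dvd_card_moved_points[OF p fin C ord] triv by blast
  ultimately have "p dvd 1" using dvd by (simp only: dvd_add_right_iff)
  with p show False by simp
qed

context finite_group
begin

lemma card_relative_prime_power:
  assumes p: "Factorial_Ring.prime p" and C: "subgroup C G" and D: "subgroup D G" and P: "subgroup P G"
    and sub: "C \<subseteq> D" "D \<subseteq> P" and cP: "card P = p ^ k * card C"
  obtains i j where "card D = p ^ i * card C" "card P = p ^ j * card D"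
proof -
  obtain d where d: "card D = card C * d"
    using subgroup_card_dvd[OF C D sub(1)] by (blast elim: dvdE)
  obtain e where e: "card P = card D * e"
    using subgroup_card_dvd[OF D P sub(2)] by (blast elim: dvdE)
  have "d * e = p ^ k" using cP subgroup_card_pos[OF C] unfolding e d by (simp add: ac_simps)
  then have "d dvd p ^ k" "e dvd p ^ k" by (metis dvd_triv_left dvd_triv_right)+
  then obtain i j where "d = p ^ i" "e = p ^ j" using divides_primepow_nat[OF p] by blast
  then show thesis using that[of i j] d e by (simp add: mult.commute)
qed

text \<open>Normalizers grow in \<open>p\<close>-groups, here applied to \<open>D / C < P / C\<close>. The group \<open>D\<close> acts on
  its cosets \<open>D x\<close> in \<open>P\<close>, and fixing \<open>D x\<close> means that \<open>x\<close> conjugates \<open>D\<close> into \<open>D\<close>.\<close>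
lemma normalizer_grows:
  assumes p: "Factorial_Ring.prime p" and C: "subgroup C G" and D: "subgroup D G" and P: "subgroup P G"
    and sub: "C \<subseteq> D" "D \<subseteq> P" "D \<noteq> P" and cP: "card P = p ^ k * card C"
    and norm: "normalizes G P C"
  obtains x where "x \<in> P" "x \<notin> D" "normalizes G {x} D"
proof -
  note [simp] = subgroup.mem_carrier[OF D] subgroup.mem_carrier[OF P]
    subgroup.m_closed[OF P] subgroup.m_inv_closed[OF P] subgroup.one_closed[OF P]
    subsetD[OF sub(2)] subset_trans[OF subgroup.subset[OF D]] subgroup.subset[OF D]
  obtain i j where cD: "card D = p ^ i * card C" and cPD: "card P = p ^ j * card D"
    using card_relative_prime_power[OF p C D P sub(1,2) cP] .
  define E where "E = rcosets\<^bsub>G\<lparr>carrier := P\<rparr>\<^esub> D"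
  have E: "E = (\<lambda>x. D #> x) ` P" by (auto simp: E_def RCOSETS_def)
  interpret D: group "G\<lparr>carrier := D\<rparr>" by (rule subgroup_imp_group[OF D])
  have coset: "D #> x #> inv g = D #> (x \<otimes> inv g)" if "x \<in> P" "g \<in> D" for x g
    using that by (simp add: coset_mult_assoc)
  define f where "f = (\<lambda>g Y. Y #> inv g)"
  interpret A: group_action "G\<lparr>carrier := D\<rparr>" E "\<lambda>g. \<lambda>Y\<in>E. f g Y"
    unfolding f_def
  proof (rule D.group_actionI)
    fix Y assume Y: "Y \<in> E"
    then obtain x where x: "x \<in> P" "Y = D #> x" by (auto simp: E)
    show "Y #> inv \<one>\<^bsub>G\<lparr>carrier := D\<rparr>\<^esub> = Y" using x by (simp add: coset_mult_assoc)
    fix g assume g: "g \<in> carrier (G\<lparr>carrier := D\<rparr>)"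
    then show "Y #> inv g \<in> E" using x coset by (auto simp: E)
    fix h assume h: "h \<in> carrier (G\<lparr>carrier := D\<rparr>)"
    show "Y #> inv (g \<otimes>\<^bsub>G\<lparr>carrier := D\<rparr>\<^esub> h) = Y #> inv h #> inv g"
      using x g h by (simp add: coset_mult_assoc group_word)
  qed
  have "card E * card D = card P" unfolding E_def by (rule order_Mod[OF P D sub(2)])
  then have cE: "card E = p ^ j" using cPD subgroup_card_pos[OF D] by simp
  have "j \<noteq> 0"
  proof
    assume "j = 0"
    then have "D = P" using cPD sub(2) subgroup_finite[OF P] by (intro card_subset_eq) auto
    with sub(3) show False by simp
  qed
  then have dvd: "p dvd card E" using cE by simp
  have D_E: "D \<in> E" unfolding E by (rule image_eqI[where x = \<one>]) simp_all
  obtain Y where Y: "Y \<in> E" "Y \<noteq> D" "\<And>g. g \<in> D \<Longrightarrow> Y #> inv g = Y"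
  proof (rule A.ex_other_fixed_point[OF p _ _ subgroup_incl[OF C D sub(1)], where y = D and k = i])
    show "finite (carrier (G\<lparr>carrier := D\<rparr>))" using subgroup_finite[OF D] by simp
    show "finite E" unfolding E using subgroup_finite[OF P] by simp
    show "order (G\<lparr>carrier := D\<rparr>) = p ^ i * card C" using cD by (simp add: order_def)
    show "p dvd card E" by (rule dvd)
    show "D \<in> E" by (rule D_E)
    show "(\<lambda>Y\<in>E. f g Y) D = D" if "g \<in> carrier (G\<lparr>carrier := D\<rparr>)" for g
      using that D_E D by (simp add: f_def coset_join2 subgroup.m_inv_closed[OF D])
    show "(\<lambda>Y\<in>E. f c Y) Y = Y" if c: "c \<in> C" and Y: "Y \<in> E" for c Y
    proof -
      obtain x where x: "x \<in> P" "Y = D #> x" using Y by (auto simp: E)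
      have cD: "c \<in> D" using c sub by blast
      have ci: "inv c \<in> C" using c subgroup.m_inv_closed[OF C] by blast
      have "x \<otimes> inv c \<otimes> inv x \<in> D" using normalizesD[OF norm x(1) ci] sub by blast
      then have "D #> (x \<otimes> inv c \<otimes> inv x) #> x = D #> x" using D x by (simp add: coset_join2)
      then show ?thesis using Y x cD coset by (simp add: f_def coset_mult_assoc group_word)
    qed
  qed (use that in \<open>auto simp: f_def\<close>)
  obtain x where x: "x \<in> P" "Y = D #> x" using Y(1) by (auto simp: E)
  have "x \<notin> D" using x Y(2) D by (auto simp: coset_join2)
  moreover have "x \<otimes> d \<otimes> inv x \<in> D" if d: "d \<in> D" for d
  proof -
    have di: "inv d \<in> D" using d subgroup.m_inv_closed[OF D] by blast
    have "D #> (x \<otimes> d) = D #> x" using Y(3)[OF di] x coset[OF x(1) di] d by simp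
    then have "x \<otimes> d \<in> D #> x" using rcos_self[OF _ D, of "x \<otimes> d"] x d by simp
    then obtain e where "e \<in> D" "x \<otimes> d = e \<otimes> x" by (auto simp: r_coset_def)
    then show ?thesis using x d by (simp add: group_word)
  qed
  ultimately show thesis using that x(1) by (auto simp: normalizes_def)
qed

text \<open>The centre of the \<open>p\<close>-group \<open>R / C\<close> is nontrivial.\<close>
lemma ex_central_modulo:
  assumes p: "Factorial_Ring.prime p" and C: "subgroup C G" and R: "subgroup R G"
    and sub: "C \<subseteq> R" "C \<noteq> R" and cR: "card R = p ^ k * card C"
    and norm: "normalizes G R C"
  obtains x where "x \<in> R" "x \<notin> C" "\<And>y. y \<in> R \<Longrightarrow> x \<otimes> y \<otimes> inv x \<otimes> inv y \<in> C"
proof -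
  note [simp] = subgroup.mem_carrier[OF C] subgroup.mem_carrier[OF R]
    subgroup.m_closed[OF R] subgroup.m_inv_closed[OF R] subgroup.one_closed[OF R]
    subgroup.subset[OF C] subsetD[OF sub(1)]
  have C_one: "C = C #> \<one>" by simp
  define E where "E = rcosets\<^bsub>G\<lparr>carrier := R\<rparr>\<^esub> C"
  have E: "E = (\<lambda>x. C #> x) ` R" by (auto simp: E_def RCOSETS_def)
  interpret R: group "G\<lparr>carrier := R\<rparr>" by (rule subgroup_imp_group[OF R])
  interpret CR: normal C "G\<lparr>carrier := R\<rparr>"
    using normal_restrict_iff[OF R sub(1)] C norm by simp
  have gC: "g <# C = C #> g" if "g \<in> R" for g using CR.coset_eq that by simp
  have conj: "g <# (C #> x) #> inv g = C #> (g \<otimes> x \<otimes> inv g)" if "g \<in> R" "x \<in> R" for g x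
  proof -
    have "g <# (C #> x) = C #> (g \<otimes> x)"
      using that by (simp add: coset_assoc gC coset_mult_assoc)
    then show ?thesis using that by (simp add: coset_mult_assoc)
  qed
  have absorb: "C #> (c \<otimes> x) = C #> x" if "c \<in> C" "x \<in> R" for c x
    using that coset_join2[of c C] C by (simp add: coset_mult_assoc[symmetric])
  define f where "f = (\<lambda>g Y. g <# Y #> inv g)"
  interpret A: group_action "G\<lparr>carrier := R\<rparr>" E "\<lambda>g. \<lambda>Y\<in>E. f g Y"
    unfolding f_def
  proof (rule R.group_actionI)
    fix Y assume Y: "Y \<in> E"
    then obtain x where x: "x \<in> R" "Y = C #> x" by (auto simp: E)
    show "\<one>\<^bsub>G\<lparr>carrier := R\<rparr>\<^esub> <# Y #> inv \<one>\<^bsub>G\<lparr>carrier := R\<rparr>\<^esub> = Y" using x conj[of \<one> x] by simp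
    fix g assume g: "g \<in> carrier (G\<lparr>carrier := R\<rparr>)"
    show "g <# Y #> inv g \<in> E" using x g conj by (auto simp: E)
    fix h assume h: "h \<in> carrier (G\<lparr>carrier := R\<rparr>)"
    show "(g \<otimes>\<^bsub>G\<lparr>carrier := R\<rparr>\<^esub> h) <# Y #> inv (g \<otimes>\<^bsub>G\<lparr>carrier := R\<rparr>\<^esub> h) = g <# (h <# Y #> inv h) #> inv g"
      using x g h conj[of "g \<otimes> h" x] by (simp add: conj group_word)
  qed
  have "card E * card C = card R" unfolding E_def by (rule order_Mod[OF R C sub(1)])
  then have cE: "card E = p ^ k" using cR subgroup_card_pos[OF C] by simp
  have "k \<noteq> 0"
  proof
    assume "k = 0"
    then have "C = R" using cR sub(1) subgroup_finite[OF R] by (intro card_subset_eq) auto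
    with sub(2) show False by simp
  qed
  then have dvd: "p dvd card E" using cE by simp
  have C_E: "C \<in> E" unfolding E using C_one subgroup.one_closed[OF R] by blast
  obtain Y where Y: "Y \<in> E" "Y \<noteq> C" "\<And>g. g \<in> R \<Longrightarrow> g <# Y #> inv g = Y"
  proof (rule A.ex_other_fixed_point[OF p _ _ subgroup_incl[OF C R sub(1)], where y = C and k = k])
    show "finite (carrier (G\<lparr>carrier := R\<rparr>))" using subgroup_finite[OF R] by simp
    show "finite E" unfolding E using subgroup_finite[OF R] by simp
    show "order (G\<lparr>carrier := R\<rparr>) = p ^ k * card C" using cR by (simp add: order_def)
    show "p dvd card E" by (rule dvd)
    show "C \<in> E" by (rule C_E)
    show "(\<lambda>Y\<in>E. f g Y) C = C" if "g \<in> carrier (G\<lparr>carrier := R\<rparr>)" for g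
      using that C_E by (simp add: f_def gC coset_mult_assoc)
    show "(\<lambda>Y\<in>E. f c Y) Y = Y" if c: "c \<in> C" and Y: "Y \<in> E" for c Y
    proof -
      obtain x where x: "x \<in> R" "Y = C #> x" using Y by (auto simp: E)
      have "x \<otimes> inv c \<otimes> inv x \<in> C"
        using normalizesD[OF norm x(1), of "inv c"] c subgroup.m_inv_closed[OF C] by blast
      then have "c \<otimes> (x \<otimes> inv c \<otimes> inv x) \<in> C" using c subgroup.m_closed[OF C] by blast
      from absorb[OF this x(1)] show ?thesis using Y x c conj by (simp add: f_def group_word)
    qed
  qed (use that in \<open>auto simp: f_def\<close>)
  obtain x where x: "x \<in> R" "Y = C #> x" using Y(1) by (auto simp: E)
  have "x \<notin> C" using x Y(2) C by (auto simp: coset_join2)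
  moreover have "x \<otimes> y \<otimes> inv x \<otimes> inv y \<in> C" if y: "y \<in> R" for y
  proof -
    have "C #> (y \<otimes> x \<otimes> inv y) = C #> x" using Y(3)[OF y] x conj[OF y x(1)] by simp
    then have "x \<in> C #> (y \<otimes> x \<otimes> inv y)" using rcos_self[OF _ C, of x] x by simp
    then obtain e where e: "e \<in> C" "e \<otimes> (y \<otimes> x \<otimes> inv y) = x" by (auto simp: r_coset_def)
    have "x \<otimes> inv (y \<otimes> x \<otimes> inv y) = e \<otimes> (y \<otimes> x \<otimes> inv y) \<otimes> inv (y \<otimes> x \<otimes> inv y)"
      by (simp only: e(2))
    also have "\<dots> = e" using e(1) x y by (simp add: group_word)
    finally have "x \<otimes> inv (y \<otimes> x \<otimes> inv y) = e" .
    then show ?thesis using x y e(1) by (simp add: group_word)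
  qed
  ultimately show thesis using that x(1) by blast
qed

end

section \<open>Minimal normal sections\<close>

text \<open>For \<open>C \<subseteq> R \<subseteq> M\<close> with \<open>C\<close> normal in \<open>M\<close>, this says that \<open>R / C\<close> is a minimal normal
  subgroup of \<open>M / C\<close>.\<close>
definition minimal_normal_over :: "('a, 'b) monoid_scheme \<Rightarrow> 'a set \<Rightarrow> 'a set \<Rightarrow> 'a set \<Rightarrow> bool"
  where "minimal_normal_over G M C R \<longleftrightarrow>
    subgroup R G \<and> normalizes G M R \<and> C \<subset> R \<and>
    (\<forall>S. subgroup S G \<longrightarrow> normalizes G M S \<longrightarrow> C \<subset> S \<longrightarrow> S \<subseteq> R \<longrightarrow> S = R)"

lemma minimal_normal_overD:
  assumes "minimal_normal_over G M C R"
  shows "subgroup R G" "normalizes G M R" "C \<subseteq> R" "C \<noteq> R"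
    and "\<And>S. subgroup S G \<Longrightarrow> normalizes G M S \<Longrightarrow> C \<subseteq> S \<Longrightarrow> S \<noteq> C \<Longrightarrow> S \<subseteq> R \<Longrightarrow> S = R"
  using assms by (auto simp: minimal_normal_over_def)

context finite_group
begin

lemma ex_minimal_normal_over:
  assumes T: "subgroup T G" "normalizes G M T" "C \<subseteq> T" "C \<noteq> T"
  obtains R where "minimal_normal_over G M C R" "R \<subseteq> T"
proof -
  let ?P = "\<lambda>S. subgroup S G \<and> normalizes G M S \<and> C \<subset> S \<and> S \<subseteq> T"
  have "?P T" using T by blast
  from ex_has_least_nat[of ?P T card, OF this]
  obtain R where R: "?P R" and least: "\<And>S. ?P S \<Longrightarrow> card R \<le> card S" by blast
  have "S = R" if S: "subgroup S G" "normalizes G M S" "C \<subset> S" "S \<subseteq> R" for S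
  proof -
    have "card R \<le> card S" by (rule least) (use S R in auto)
    then show ?thesis using R by (intro card_seteq[OF subgroup_finite S(4)]) simp_all
  qed
  then have "minimal_normal_over G M C R" using R by (simp add: minimal_normal_over_def)
  then show thesis using R that by blast
qed

lemma p_solvable_series:
  assumes "p_solvable p G"
  obtains n H where "H 0 = {\<one>}" "H n = carrier G" "\<And>i. i \<le> n \<Longrightarrow> subgroup (H i) G"
    "\<And>i. i \<le> n \<Longrightarrow> normalizes G (carrier G) (H i)"
    "\<And>i. i < n \<Longrightarrow> H i \<subseteq> H (Suc i)"
    "\<And>i. i < n \<Longrightarrow> \<exists>m. card (H (Suc i)) = m * card (H i) \<and> ((\<exists>k. m = p ^ k) \<or> \<not> p dvd m)"
proof -
  obtain n H where H0: "H 0 = {\<one>}" "H n = carrier G" and norm: "\<And>i. i \<le> n \<Longrightarrow> H i \<lhd> G"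
    and step: "\<And>i. i < n \<Longrightarrow> H i \<subseteq> H (Suc i) \<and>
        (finite_p_group p (G\<lparr>carrier := H (Suc i)\<rparr> Mod H i) \<or>
         \<not> p dvd order (G\<lparr>carrier := H (Suc i)\<rparr> Mod H i))"
    using assms unfolding p_solvable_def by blast
  have sub: "subgroup (H i) G" "normalizes G (carrier G) (H i)" if "i \<le> n" for i
    using norm[OF that] by (simp_all add: normal_iff_normalizes)
  have "\<exists>m. card (H (Suc i)) = m * card (H i) \<and> ((\<exists>k. m = p ^ k) \<or> \<not> p dvd m)" if i: "i < n" for i
  proof -
    have "order (G\<lparr>carrier := H (Suc i)\<rparr> Mod H i) * card (H i) = card (H (Suc i))"
      using order_Mod[of "H (Suc i)" "H i"] sub i step by (simp add: order_def FactGroup_def)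
    then show ?thesis using step[OF i] unfolding finite_p_group_def by metis
  qed
  then show thesis using that[of H n] H0 sub step by blast
qed

lemma minimal_normal_over_p_solvable:
  assumes solv: "p_solvable p G" and p: "Factorial_Ring.prime p"
    and C: "subgroup C G" and norm: "normalizes G M C"
    and min: "minimal_normal_over G M C R" and RM: "R \<subseteq> M" and M: "subgroup M G"
  obtains m where "card R = m * card C" "(\<exists>k. m = p ^ k) \<or> \<not> p dvd m"
proof -
  obtain n H where H0: "H 0 = {\<one>}" and Hn: "H n = carrier G"
    and Hs: "\<And>i. i \<le> n \<Longrightarrow> subgroup (H i) G"
    and Hnorm: "\<And>i. i \<le> n \<Longrightarrow> normalizes G (carrier G) (H i)"
    and Hsub: "\<And>i. i < n \<Longrightarrow> H i \<subseteq> H (Suc i)"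
    and Hcard: "\<And>i. i < n \<Longrightarrow> \<exists>m. card (H (Suc i)) = m * card (H i) \<and> ((\<exists>k. m = p ^ k) \<or> \<not> p dvd m)"
    using p_solvable_series[OF solv] by metis
  note R = minimal_normal_overD[OF min]
  have Rc: "R \<subseteq> carrier G" and Mc: "M \<subseteq> carrier G" using R(1) M by (simp_all add: subgroup.subset)
  \<comment> \<open>The first term of the series whose intersection with \<open>R\<close> is not contained in \<open>C\<close>.\<close>
  define i where "i = (LEAST i. \<not> H i \<inter> R \<subseteq> C)"
  have "\<not> H n \<inter> R \<subseteq> C" using Hn Rc R(3,4) by blast
  then have i: "\<not> H i \<inter> R \<subseteq> C" "i \<le> n" unfolding i_def by (rule LeastI, rule Least_le)
  have "i \<noteq> 0" using i(1) H0 subgroup.one_closed[OF C] by (intro notI) auto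
  then obtain j where j: "i = Suc j" by (cases i) auto
  then have "j < i" by simp
  then have jC: "H j \<inter> R \<subseteq> C" using not_less_Least unfolding i_def by blast
  have jn: "j < n" using i(2) j by simp
  define A where "A = H i \<inter> R"
  define B where "B = H j \<inter> R"
  have A: "subgroup A G" and B: "subgroup B G" and Hj: "subgroup (H j) G"
    using subgroups_Inter_pair[OF Hs R(1)] Hs i(2) jn unfolding A_def B_def by simp_all
  have AC: "subgroup (A \<inter> C) G" using A C by (rule subgroups_Inter_pair)
  have Anorm: "normalizes G M A"
    unfolding A_def using normalizes_Int normalizes_mono Hnorm i(2) R(2) Mc by blast
  have AM: "A \<subseteq> M" using RM by (auto simp: A_def)
  have "subgroup (A <#> C) G"
    using subgroup_set_mult[OF A C] normalizes_mono[OF norm AM] .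
  moreover have "normalizes G M (A <#> C)"
    using normalizes_set_mult[OF Mc _ _ Anorm norm] A C by (simp add: subgroup.subset)
  moreover have sub: "A \<subseteq> A <#> C" "C \<subseteq> A <#> C"
    using subset_set_mult1[of A C] subset_set_mult2[of A C] A C by (simp_all add: subgroup.subset)
  moreover have "A <#> C \<noteq> C" using sub i(1) unfolding A_def by blast
  moreover have "A <#> C \<subseteq> R" using set_mult_subset[OF R(1)] R(3) unfolding A_def by blast
  ultimately have RAC: "A <#> C = R" by (rule_tac R(5))
  obtain a where a: "card A = card (A \<inter> C) * a"
    using subgroup_card_dvd[OF AC A] by (blast elim: dvdE)
  have cR: "card R = a * card C"
    using card_set_mult[OF A C] RAC a subgroup_card_pos[OF AC] by simp
  have BA: "B \<subseteq> A \<inter> C" using jC Hsub[OF jn] by (auto simp: A_def B_def j)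
  obtain b where b: "card (A \<inter> C) = card B * b"
    using subgroup_card_dvd[OF B AC BA] by (blast elim: dvdE)
  have AH: "subgroup (A <#> H j) G"
    using subgroup_set_mult[OF A Hj] normalizes_mono[OF Hnorm] jn subgroup.subset[OF A] by simp
  have HAH: "H j \<subseteq> A <#> H j" using subset_set_mult2[OF A] subgroup.subset[OF Hj] .
  obtain t where t: "card (A <#> H j) = card (H j) * t"
    using subgroup_card_dvd[OF Hj AH HAH] by (blast elim: dvdE)
  have "A <#> H j \<subseteq> H i" using set_mult_subset[OF Hs[OF i(2)]] Hsub[OF jn] by (auto simp: A_def j)
  then obtain s where s: "card (H i) = card (A <#> H j) * s"
    using subgroup_card_dvd[OF AH Hs[OF i(2)]] by (blast elim: dvdE)
  have "A \<inter> H j = B" using Hsub[OF jn] by (auto simp: A_def B_def j)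
  then have "card (H j) * t * card B = card B * b * a * card (H j)"
    using card_set_mult[OF A Hj] t a b by simp
  then have tab: "t = a * b" using subgroup_card_pos[OF B] subgroup_card_pos[OF Hj] by simp
  obtain m where m: "card (H i) = m * card (H j)" "(\<exists>k. m = p ^ k) \<or> \<not> p dvd m"
    using Hcard[OF jn] j by blast
  have "m = a * (b * s)"
    using m(1) subgroup_card_pos[OF Hj] unfolding s t tab by (simp add: ac_simps)
  then have "a dvd m" by simp
  with m(2) have "(\<exists>k. a = p ^ k) \<or> \<not> p dvd a"
    using divides_primepow_nat[OF p] dvd_trans by blast
  with cR show thesis by (rule that)
qed

text \<open>The centre of the \<open>p\<close>-group \<open>R / C\<close> is normal in \<open>M / C\<close> and nontrivial, so it is all of \<open>R / C\<close>.\<close>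
lemma minimal_normal_over_abelian:
  assumes p: "Factorial_Ring.prime p"
    and C: "subgroup C G" and norm: "normalizes G M C"
    and min: "minimal_normal_over G M C R" and RM: "R \<subseteq> M" and M: "subgroup M G"
    and cR: "card R = p ^ k * card C"
    and xy: "x \<in> R" "y \<in> R"
  shows "x \<otimes> y \<otimes> inv x \<otimes> inv y \<in> C"
proof -
  note R = minimal_normal_overD[OF min]
  note [simp] = subgroup.mem_carrier[OF R(1)] subgroup.mem_carrier[OF C] subgroup.mem_carrier[OF M]
    subgroup.m_closed[OF R(1)] subgroup.m_inv_closed[OF R(1)] subgroup.one_closed[OF R(1)]
    subgroup.m_closed[OF C] subgroup.m_inv_closed[OF C] subgroup.one_closed[OF C]
    subgroup.m_inv_closed[OF M]
  have normR: "normalizes G R C" using norm RM by (rule normalizes_mono)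
  define Z where "Z = {x \<in> R. \<forall>y\<in>R. x \<otimes> y \<otimes> inv x \<otimes> inv y \<in> C}"
  have ZR: "Z \<subseteq> R" by (auto simp: Z_def)
  have "subgroup Z G"
  proof (rule subgroupI)
    show "Z \<subseteq> carrier G" using ZR by auto
    have "\<one> \<in> Z" by (auto simp: Z_def)
    then show "Z \<noteq> {}" by blast
    fix a assume a: "a \<in> Z"
    have "inv a \<otimes> y \<otimes> inv (inv a) \<otimes> inv y \<in> C" if y: "y \<in> R" for y
    proof -
      have "inv a \<otimes> inv (a \<otimes> y \<otimes> inv a \<otimes> inv y) \<otimes> inv (inv a) \<in> C"
        using a y normalizesD[OF normR, of "inv a"] by (simp add: Z_def)
      then show ?thesis using a y by (simp add: Z_def group_word)
    qed
    then show "inv a \<in> Z" using a by (auto simp: Z_def)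
    fix b assume b: "b \<in> Z"
    have "a \<otimes> b \<otimes> y \<otimes> inv (a \<otimes> b) \<otimes> inv y \<in> C" if y: "y \<in> R" for y
    proof -
      have "a \<otimes> (b \<otimes> y \<otimes> inv b \<otimes> inv y) \<otimes> inv a \<otimes> (a \<otimes> y \<otimes> inv a \<otimes> inv y) \<in> C"
        using a b y normalizesD[OF normR, of a] by (simp add: Z_def)
      then show ?thesis using a b y by (simp add: Z_def group_word)
    qed
    then show "a \<otimes> b \<in> Z" using a b by (auto simp: Z_def)
  qed
  moreover have "normalizes G M Z"
    unfolding normalizes_def
  proof (intro ballI)
    fix m a assume m: "m \<in> M" and a: "a \<in> Z"
    have "m \<otimes> a \<otimes> inv m \<otimes> y \<otimes> inv (m \<otimes> a \<otimes> inv m) \<otimes> inv y \<in> C" if y: "y \<in> R" for y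
    proof -
      define w where "w = inv m \<otimes> y \<otimes> inv (inv m)"
      have w: "w \<in> R" unfolding w_def using normalizesD[OF R(2), of "inv m" y] m y by simp
      then have "m \<otimes> (a \<otimes> w \<otimes> inv a \<otimes> inv w) \<otimes> inv m \<in> C"
        using a m normalizesD[OF norm m] by (simp add: Z_def)
      then show ?thesis using a m y by (simp add: Z_def w_def group_word)
    qed
    then show "m \<otimes> a \<otimes> inv m \<in> Z" using a m normalizesD[OF R(2) m, of a] by (auto simp: Z_def)
  qed
  moreover have "C \<subseteq> Z"
  proof
    fix c assume c: "c \<in> C"
    have "c \<otimes> y \<otimes> inv c \<otimes> inv y \<in> C" if y: "y \<in> R" for y
    proof -
      have "c \<otimes> (y \<otimes> inv c \<otimes> inv y) \<in> C" using c y normalizesD[OF normR y] by simp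
      then show ?thesis using c y by (simp add: group_word)
    qed
    then show "c \<in> Z" using c R(3) by (auto simp: Z_def)
  qed
  moreover have "Z \<noteq> C"
  proof -
    obtain x where "x \<in> R" "x \<notin> C" "\<And>y. y \<in> R \<Longrightarrow> x \<otimes> y \<otimes> inv x \<otimes> inv y \<in> C"
      using ex_central_modulo[OF p C R(1,3,4) cR normR] by metis
    then show ?thesis by (auto simp: Z_def)
  qed
  ultimately have "Z = R" using ZR by (rule R(5))
  then show ?thesis using xy by (auto simp: Z_def)
qed

end

section \<open>Complements and Hall subgroups\<close>

text \<open>Here \<open>G\<close> is an abelian subgroup \<open>A\<close> of \<open>G'\<close>, and conjugation by an element \<open>x\<close> of \<open>G'\<close>
  that normalizes \<open>A\<close> commutes with products in \<open>A\<close>.\<close>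
lemma (in comm_group) finprod_conj:
  assumes G: "group G'" and sub: "G = G'\<lparr>carrier := A\<rparr>" "subgroup A G'" and x: "x \<in> carrier G'"
    and norm: "normalizes G' {x} A" and fin: "finite E" and f: "f \<in> E \<rightarrow> carrier G"
  shows "finprod G (\<lambda>i. x \<otimes>\<^bsub>G'\<^esub> f i \<otimes>\<^bsub>G'\<^esub> inv\<^bsub>G'\<^esub> x) E = x \<otimes>\<^bsub>G'\<^esub> finprod G f E \<otimes>\<^bsub>G'\<^esub> inv\<^bsub>G'\<^esub> x"
  using fin f
proof (induction E rule: finite_induct)
  case empty
  have "finprod G h {} = \<one>\<^bsub>G'\<^esub>" for h :: "'c \<Rightarrow> 'a" by (simp only: finprod_empty) (simp add: sub)
  then show ?case using G x by (simp add: group.is_monoid monoid.r_one group.r_inv)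
next
  interpret G': group G' by (rule G)
  case (insert i E)
  let ?c = "\<lambda>a. x \<otimes>\<^bsub>G'\<^esub> a \<otimes>\<^bsub>G'\<^esub> inv\<^bsub>G'\<^esub> x"
  have c: "?c a \<in> carrier G" if "a \<in> carrier G" for a
    using that normalizesD[OF norm] by (simp add: sub)
  have fi: "f i \<in> carrier G" "f \<in> E \<rightarrow> carrier G" using insert.prems by auto
  have p: "finprod G f E \<in> carrier G" using fi(2) by (rule finprod_closed)
  have Ac: "a \<in> carrier G'" if "a \<in> carrier G" for a
    using that subgroup.mem_carrier[OF sub(2)] by (simp add: sub)
  have "finprod G (\<lambda>i. ?c (f i)) (insert i E) = ?c (f i) \<otimes> finprod G (\<lambda>i. ?c (f i)) E"
    using insert.hyps fi c by (subst finprod_insert) auto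
  also have "\<dots> = ?c (f i) \<otimes> ?c (finprod G f E)" using insert.IH fi by simp
  also have "\<dots> = ?c (f i) \<otimes>\<^bsub>G'\<^esub> ?c (finprod G f E)" by (simp add: sub)
  also have "\<dots> = ?c (f i \<otimes>\<^bsub>G'\<^esub> finprod G f E)"
    using Ac[OF fi(1)] Ac[OF p] x by (simp add: G'.group_word)
  also have "f i \<otimes>\<^bsub>G'\<^esub> finprod G f E = finprod G f (insert i E)"
    using insert.hyps fi by (subst finprod_insert) (auto simp: sub)
  finally show ?case .
qed

context finite_group
begin

text \<open>The abelian case of the Schur-Zassenhaus theorem. Choose representatives \<open>t Y\<close> of the
  cosets \<open>Y\<close> of \<open>A\<close> and let \<open>\<psi> g\<close> be the product of all \<open>g t(Y) t(g Y)\<inverse> \<in> A\<close>. Then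
  \<open>\<psi> (g h) = g \<psi>(h) g\<inverse> \<psi>(g)\<close> and \<open>\<psi> a = a\<^sup>n\<close> on \<open>A\<close>, where \<open>n = |G : A|\<close>. As \<open>n\<close>
  is coprime to \<open>|A|\<close>, the map \<open>a \<mapsto> a\<^sup>n\<close> is bijective on \<open>A\<close>. So the subgroup of all
  \<open>g\<close> with \<open>\<psi> g = 1\<close> is a complement of \<open>A\<close>.\<close>
lemma abelian_normal_complement:
  assumes A: "A \<lhd> G" and comm: "\<And>a b. a \<in> A \<Longrightarrow> b \<in> A \<Longrightarrow> a \<otimes> b = b \<otimes> a"
    and ord: "order G = n * card A" and cop: "coprime (card A) n"
  obtains K where "subgroup K G" "order G = card K * card A"
proof -
  have As: "subgroup A G" and norm: "normalizes G (carrier G) A" using A by (simp_all add: normal_iff_normalizes)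
  note [simp] = subgroup.mem_carrier[OF As] subgroup.m_closed[OF As] subgroup.m_inv_closed[OF As]
    subgroup.one_closed[OF As] subgroup.subset[OF As]
  interpret A: normal A G by (rule A)
  define A' where "A' = G\<lparr>carrier := A\<rparr>"
  have A'simps [simp]: "carrier A' = A" "\<And>x y. x \<otimes>\<^bsub>A'\<^esub> y = x \<otimes> y" "\<one>\<^bsub>A'\<^esub> = \<one>" by (simp_all add: A'_def)
  interpret A': comm_group A'
    unfolding A'_def by (rule group.group_comm_groupI[OF subgroup_imp_group[OF As]]) (simp add: comm)
  define E where "E = rcosets A"
  have E: "E = (\<lambda>x. A #> x) ` carrier G" by (auto simp: E_def RCOSETS_def)
  have finE: "finite E" unfolding E using finite_carrier by simp
  have cE: "card E = n"
    using lagrange[OF As] ord subgroup_card_pos[OF As] by (simp add: E_def)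
  define t where "t = (\<lambda>Y. SOME x. x \<in> (Y :: 'a set))"
  have t: "t Y \<in> Y" if Y: "Y \<in> E" for Y
  proof -
    obtain x where "x \<in> carrier G" "Y = A #> x" using Y by (auto simp: E)
    then have "x \<in> Y" using rcos_self As by simp
    then show ?thesis unfolding t_def by (rule someI)
  qed
  have tc [simp]: "t Y \<in> carrier G" if Y: "Y \<in> E" for Y
    using t[OF Y] Y r_coset_subset_G[of A] by (auto simp: E)
  have tY: "A #> t Y = Y" if Y: "Y \<in> E" for Y
    using t[OF Y] Y repr_independence[OF _ _ As] by (auto simp: E)
  \<comment> \<open>The left action of \<open>G\<close> on the cosets of \<open>A\<close>.\<close>
  define s where "s = (\<lambda>g Y. A #> (g \<otimes> t Y))"
  have eq_coset: "A #> x = A #> y" if xy: "x \<in> carrier G" "y \<in> carrier G" "x \<otimes> inv y \<in> A" for x y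
  proof -
    have "x = x \<otimes> inv y \<otimes> y" using xy by (simp add: group_word)
    then have "x \<in> A #> y" using xy(3) unfolding r_coset_def by blast
    then show ?thesis using repr_independence[OF _ xy(2) As] by simp
  qed
  have sE: "s g Y \<in> E" if "g \<in> carrier G" "Y \<in> E" for g Y
    using that by (auto simp: s_def E intro!: imageI)
  have s_coset: "s g (A #> x) = A #> (g \<otimes> x)" if g: "g \<in> carrier G" and x: "x \<in> carrier G" for g x
  proof -
    have YE: "A #> x \<in> E" using x by (auto simp: E)
    from t[OF YE] obtain a where a: "a \<in> A" "t (A #> x) = a \<otimes> x" by (auto simp: r_coset_def)
    have "g \<otimes> a \<otimes> inv g \<in> A" using normalizesD[OF norm g a(1)] .
    then show ?thesis unfolding s_def a(2) using a(1) g x by (intro eq_coset) (simp_all add: group_word)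
  qed
  have s_mult: "s (g \<otimes> h) Y = s g (s h Y)" if "g \<in> carrier G" "h \<in> carrier G" "Y \<in> E" for g h Y
    using that s_coset[of g "h \<otimes> t Y"] by (simp add: s_def m_assoc)
  have s_one: "s \<one> Y = Y" if "Y \<in> E" for Y using that by (simp add: s_def tY)
  have s_bij: "bij_betw (s g) E E" if g: "g \<in> carrier G" for g
    by (rule bij_betw_byWitness[where f' = "s (inv g)"])
       (use g in \<open>auto simp: s_mult[symmetric] s_one sE\<close>)
  define d where "d = (\<lambda>g Y. g \<otimes> t Y \<otimes> inv (t (s g Y)))"
  have dA: "d g Y \<in> A" if g: "g \<in> carrier G" and Y: "Y \<in> E" for g Y
  proof -
    have "g \<otimes> t Y \<in> A #> (g \<otimes> t Y)" using g Y rcos_self As by simp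
    then have "g \<otimes> t Y \<in> A #> t (s g Y)" using tY[OF sE[OF g Y]] by (simp add: s_def)
    then obtain a where a: "a \<in> A" "a \<otimes> t (s g Y) = g \<otimes> t Y" by (auto simp: r_coset_def)
    have "d g Y = a" unfolding d_def a(2)[symmetric] using a(1) sE[OF g Y] by (simp add: group_word)
    with a(1) show ?thesis by simp
  qed
  have d_mult: "d (g \<otimes> h) Y = (g \<otimes> d h Y \<otimes> inv g) \<otimes> d g (s h Y)"
    if "g \<in> carrier G" "h \<in> carrier G" "Y \<in> E" for g h Y
    using that by (simp add: d_def s_mult sE group_word)
  define \<psi> where "\<psi> = (\<lambda>g. finprod A' (d g) E)"
  have \<psi>A: "\<psi> g \<in> A" if "g \<in> carrier G" for g
    using A'.finprod_closed[of "d g" E] dA[OF that] by (auto simp: \<psi>_def)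
  have \<psi>_mult: "\<psi> (g \<otimes> h) = (g \<otimes> \<psi> h \<otimes> inv g) \<otimes> \<psi> g" if g: "g \<in> carrier G" and h: "h \<in> carrier G" for g h
  proof -
    have cl: "g \<otimes> d h Y \<otimes> inv g \<in> A" if "Y \<in> E" for Y using normalizesD[OF norm g dA[OF h that]] .
    have "\<psi> (g \<otimes> h) = finprod A' (\<lambda>Y. (g \<otimes> d h Y \<otimes> inv g) \<otimes>\<^bsub>A'\<^esub> d g (s h Y)) E"
      unfolding \<psi>_def using g h dA sE cl by (intro A'.finprod_cong') (auto simp: d_mult)
    also have "\<dots> = finprod A' (\<lambda>Y. g \<otimes> d h Y \<otimes> inv g) E \<otimes>\<^bsub>A'\<^esub> finprod A' (\<lambda>Y. d g (s h Y)) E"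
      using g h dA sE cl by (intro A'.finprod_multf) auto
    also have "finprod A' (\<lambda>Y. g \<otimes> d h Y \<otimes> inv g) E = g \<otimes> \<psi> h \<otimes> inv g"
      unfolding \<psi>_def using g h dA normalizes_mono[OF norm] finE
      by (intro A'.finprod_conj[OF is_group A'_def As]) auto
    also have "finprod A' (\<lambda>Y. d g (s h Y)) E = finprod A' (d g) (s h ` E)"
      using s_bij[OF h] g h dA sE by (intro A'.finprod_reindex[symmetric]) (auto simp: bij_betw_def)
    also have "\<dots> = \<psi> g" using s_bij[OF h] by (simp add: bij_betw_def \<psi>_def)
    finally show ?thesis by simp
  qed
  have \<psi>_pow: "\<psi> a = a [^] n" if a: "a \<in> A" for a
  proof -
    have "d a Y = a" if Y: "Y \<in> E" for Y
    proof -
      have "s a Y = Y"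
        using Y a tY eq_coset[of "a \<otimes> t Y" "t Y"] by (simp add: s_def group_word)
      then show ?thesis using Y a by (simp add: d_def group_word)
    qed
    then have "\<psi> a = finprod A' (\<lambda>Y. a) E"
      unfolding \<psi>_def using a by (intro A'.finprod_cong') auto
    also have "\<dots> = a [^]\<^bsub>A'\<^esub> card E" using a by (intro A'.finprod_const) simp
    finally show ?thesis using nat_pow_consistent[of a n A] by (simp add: cE A'_def)
  qed
  have n0: "n \<noteq> 0" using ord order_gt_0_iff_finite finite_carrier by (intro notI) simp
  \<comment> \<open>The inverse of \<open>a \<mapsto> a\<^sup>n\<close> on \<open>A\<close> is \<open>a \<mapsto> a\<^sup>u\<close>.\<close>
  from bezout_nat[OF n0, of "card A"] obtain u v where uv: "n * u = card A * v + 1"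
    using cop by (auto simp: coprime_iff_gcd_eq_1 gcd.commute)
  have root: "a [^] (n * u) = a" if a: "a \<in> A" for a
  proof -
    have "a [^]\<^bsub>A'\<^esub> card A = \<one>" using A'.pow_order_eq_1[of a] a by (simp add: order_def)
    then have "a [^] card A = \<one>" using nat_pow_consistent[of a "card A" A] by (simp add: A'_def)
    then show ?thesis using a by (simp add: uv nat_pow_mult[symmetric] nat_pow_pow[symmetric] flip: power_mult)
  qed
  define K where "K = {g \<in> carrier G. \<psi> g = \<one>}"
  have K: "subgroup K G"
  proof (rule subgroupI)
    have \<psi>1: "\<psi> \<one> = \<one>" using \<psi>_pow[of \<one>] by simp
    then show "K \<noteq> {}" by (auto simp: K_def)
    show "K \<subseteq> carrier G" by (auto simp: K_def)
    fix g assume g: "g \<in> K"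
    then have "\<psi> (g \<otimes> inv g) = (g \<otimes> \<psi> (inv g) \<otimes> inv g) \<otimes> \<one>" by (subst \<psi>_mult) (auto simp: K_def)
    then have 1: "g \<otimes> \<psi> (inv g) \<otimes> inv g = \<one>" using g \<psi>1 \<psi>A[of "inv g"] by (simp add: K_def)
    have "\<psi> (inv g) = inv g \<otimes> (g \<otimes> \<psi> (inv g) \<otimes> inv g) \<otimes> g"
      using g \<psi>A[of "inv g"] by (simp add: K_def group_word)
    also have "\<dots> = \<one>" unfolding 1 using g by (simp add: K_def)
    finally show "inv g \<in> K" using g by (simp add: K_def)
    fix h assume "h \<in> K"
    then show "g \<otimes> h \<in> K" using g \<psi>_mult[of g h] by (simp add: K_def)
  qed
  have "A \<inter> K = {\<one>}"
  proof -
    have "a = \<one>" if "a \<in> A" "a \<in> K" for a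
      using that \<psi>_pow[of a] root[of a] by (simp add: K_def nat_pow_pow[symmetric])
    then show ?thesis using subgroup.one_closed[OF K] by auto
  qed
  moreover have "A <#> K = carrier G"
  proof
    show "A <#> K \<subseteq> carrier G" using setmult_subset_G subgroup.subset[OF K] by simp
    show "carrier G \<subseteq> A <#> K"
    proof
      fix g assume g: "g \<in> carrier G"
      define b where "b = inv (\<psi> g)"
      have b: "b \<in> A" using \<psi>A[OF g] by (simp add: b_def)
      define a where "a = b [^] u"
      have a: "a \<in> A" unfolding a_def using A'.nat_pow_closed[of b u] b nat_pow_consistent[of b u A] by (simp add: A'_def)
      have an: "a [^] n = b" unfolding a_def using root[OF b] b by (simp add: nat_pow_pow mult.commute)
      have "\<psi> (a \<otimes> g) = a \<otimes> \<psi> g \<otimes> inv a \<otimes> b" using \<psi>_mult[of a g] \<psi>_pow a g an by simp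
      also have "\<dots> = \<one>" using a g \<psi>A[OF g] comm[of a "\<psi> g"] by (simp add: b_def group_word)
      finally have "a \<otimes> g \<in> K" using a g by (simp add: K_def)
      moreover have "g = inv a \<otimes> (a \<otimes> g)" using a g by (simp add: group_word)
      ultimately show "g \<in> A <#> K" using a unfolding set_mult_def by force
    qed
  qed
  ultimately have "order G = card K * card A"
    using card_set_mult[OF As K] by (simp add: order_def)
  with K show thesis by (rule that)
qed

lemma cosets_commute:
  assumes K: "subgroup K G" and EK: "E \<lhd> G\<lparr>carrier := K\<rparr>" and xy: "x \<in> K" "y \<in> K"
    and comm: "x \<otimes> y \<otimes> inv x \<otimes> inv y \<in> E"
  shows "(E #> x) <#> (E #> y) = (E #> y) <#> (E #> x)"
proof -
  interpret EK: normal E "G\<lparr>carrier := K\<rparr>" by (rule EK)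
  have E: "subgroup E G" by (rule incl_subgroup[OF K EK.subgroup_axioms])
  note [simp] = subgroup.mem_carrier[OF K]
  have "x \<otimes> y = (x \<otimes> y \<otimes> inv x \<otimes> inv y) \<otimes> (y \<otimes> x)" using xy by (simp add: group_word)
  then have "x \<otimes> y \<in> E #> (y \<otimes> x)" using comm unfolding r_coset_def by blast
  then have "E #> (x \<otimes> y) = E #> (y \<otimes> x)" using repr_independence[OF _ _ E] xy by simp
  then show ?thesis using xy EK.rcos_sum[of x y] EK.rcos_sum[of y x] by simp
qed

text \<open>The abelian Schur-Zassenhaus theorem for the normal subgroup \<open>D / E\<close> of \<open>K / E\<close>. The subgroup \<open>L / E\<close> is a
  complement, but only its index is recorded.\<close>
lemma abelian_section_complement:
  assumes E: "subgroup E G" and D: "subgroup D G" and K: "subgroup K G"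
    and sub: "E \<subseteq> D" "D \<subseteq> K" and norm: "normalizes G K E" "normalizes G K D"
    and comm: "\<And>x y. x \<in> D \<Longrightarrow> y \<in> D \<Longrightarrow> x \<otimes> y \<otimes> inv x \<otimes> inv y \<in> E"
    and cD: "card D = u * card E" and cK: "card K = v * card D" and cop: "coprime u v"
  obtains L where "subgroup L G" "L \<subseteq> K" "card K = u * card L"
proof -
  define Q where "Q = G\<lparr>carrier := K\<rparr> Mod E"
  interpret GK: finite_group "G\<lparr>carrier := K\<rparr>" by (rule finite_group_subgroup[OF K])
  have EK: "E \<lhd> G\<lparr>carrier := K\<rparr>" and DK: "D \<lhd> G\<lparr>carrier := K\<rparr>"
    using normal_restrict_iff[OF K] E D sub norm by auto
  interpret EK: normal E "G\<lparr>carrier := K\<rparr>" by (rule EK)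
  interpret Q: finite_group Q unfolding Q_def by (rule GK.finite_group_Mod[OF EK])
  note [simp] = subgroup.mem_carrier[OF E] subgroup.mem_carrier[OF D] subgroup.mem_carrier[OF K]
    subgroup.m_closed[OF D] subsetD[OF sub(2)] subgroup.subset[OF E]
  define A where "A = rcosets\<^bsub>G\<lparr>carrier := D\<rparr>\<^esub> E"
  have A: "A \<lhd> Q" using GK.normality_factorization[OF EK sub(1) DK] by (simp add: A_def Q_def)
  have A_eq: "A = (\<lambda>x. E #> x) ` D" by (auto simp: A_def RCOSETS_def)
  have cA: "card A = u" using order_Mod[OF D E sub(1)] cD subgroup_card_pos[OF E] by (simp add: A_def)
  have oQ: "order Q = v * card A"
    using order_Mod[OF K E] sub cK cD cA subgroup_card_pos[OF E]
    by (simp add: Q_def order_def FactGroup_def flip: mult.assoc)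
  have commA: "a \<otimes>\<^bsub>Q\<^esub> b = b \<otimes>\<^bsub>Q\<^esub> a" if ab: "a \<in> A" "b \<in> A" for a b
  proof -
    obtain x y where xy: "x \<in> D" "a = E #> x" "y \<in> D" "b = E #> y" using ab by (auto simp: A_eq)
    then show ?thesis using cosets_commute[OF K EK _ _ comm] sub(2) by (simp add: Q_def subset_iff)
  qed
  obtain L' where L': "subgroup L' Q" "order Q = card L' * card A"
    using Q.abelian_normal_complement[OF A commA oQ] cop cA by blast
  define L where "L = \<Union>L'"
  have L: "subgroup L (G\<lparr>carrier := K\<rparr>)"
    using EK.factgroup_subgroup_union_subgroup L'(1) by (simp add: L_def Q_def)
  have LG: "subgroup L G" by (rule incl_subgroup[OF K L])
  have "E \<in> L'" using subgroup.one_closed[OF L'(1)] by (simp add: Q_def)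
  then have EL: "E \<subseteq> L" by (auto simp: L_def)
  have "L' = rcosets\<^bsub>G\<lparr>carrier := L\<rparr>\<^esub> E"
    using EK.factgroup_subgroup_union_factor[of L'] L'(1) by (simp add: L_def Q_def)
  then have "card L = card L' * card E" using order_Mod[OF LG E EL] by simp
  moreover have "card A > 0" using Q.subgroup_card_pos[OF normal_imp_subgroup[OF A]] .
  then have "card L' = v" using L'(2) oQ by simp
  ultimately have "card K = u * card L" using cK cD by simp
  moreover have "L \<subseteq> K" using subgroup.subset[OF L] by simp
  ultimately show thesis using LG that by blast
qed

text \<open>Among the subgroups of \<open>M\<close> whose index is a power of \<open>p\<close>, one of least order, \<open>K\<close>, is a
  Hall \<open>p'\<close>-subgroup. Otherwise a largest normal subgroup \<open>E\<close> of \<open>K\<close> with \<open>p\<close> dividing \<open>|K : E|\<close> has a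
  minimal normal section \<open>D / E\<close> above it, which is an abelian \<open>p\<close>-group of index prime to \<open>p\<close> in
  \<open>K / E\<close>. A complement of it yields a smaller subgroup of \<open>p\<close>-power index.\<close>
lemma ex_hall_p'_subgroup:
  assumes solv: "p_solvable p G" and p: "Factorial_Ring.prime p" and M: "subgroup M G"
  obtains K k where "subgroup K G" "K \<subseteq> M" "\<not> p dvd card K" "card M = p ^ k * card K"
proof -
  let ?P = "\<lambda>K. subgroup K G \<and> K \<subseteq> M \<and> (\<exists>k. card M = p ^ k * card K)"
  have "?P M" using M by (auto intro: exI[of _ 0])
  from ex_has_least_nat[of ?P M card, OF this]
  obtain K where K: "subgroup K G" "K \<subseteq> M" "\<exists>k. card M = p ^ k * card K"
    and least: "\<And>L. ?P L \<Longrightarrow> card K \<le> card L" by blast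
  have "\<not> p dvd card K"
  proof
    assume dvd: "p dvd card K"
    let ?R = "\<lambda>E. subgroup E G \<and> normalizes G K E \<and> E \<subseteq> K \<and> (\<exists>m. card K = m * card E \<and> p dvd m)"
    have "normalizes G K {\<one>}" using K(1) by (simp add: normalizes_def subgroup.mem_carrier)
    then have "?R {\<one>}" using triv_subgroup dvd subgroup.one_closed[OF K(1)] by simp
    moreover have "\<forall>E. ?R E \<longrightarrow> card E < Suc (card K)"
      using card_mono[OF subgroup_finite[OF K(1)]] by (simp add: less_Suc_eq_le)
    ultimately have "\<exists>E. ?R E \<and> (\<forall>F. ?R F \<longrightarrow> card F \<le> card E)"
      by (rule Lattices_Big.ex_has_greatest_nat)
    then obtain E where E: "?R E" and most: "\<And>F. ?R F \<Longrightarrow> card F \<le> card E" by metis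
    obtain m where m: "card K = m * card E" "p dvd m" using E by blast
    have "E \<noteq> K"
    proof
      assume "E = K"
      then have "m = 1" using m(1) subgroup_card_pos[OF K(1)] by simp
      then show False using m(2) p by simp
    qed
    then obtain D where D: "minimal_normal_over G K E D" and DK: "D \<subseteq> K"
      using ex_minimal_normal_over[of K K E] K(1) E normalizes_self by blast
    note D' = minimal_normal_overD[OF D]
    obtain v where v: "card K = v * card D"
      using subgroup_card_dvd[OF D'(1) K(1) DK] by (metis dvd_def mult.commute)
    have "card E < card D"
      using D'(3,4) subgroup_finite[OF D'(1)] by (intro psubset_card_mono) auto
    then have nv: "\<not> p dvd v" using most[of D] D'(1,2) DK v by force
    obtain u where u: "card D = u * card E" "(\<exists>k. u = p ^ k) \<or> \<not> p dvd u"
      using minimal_normal_over_p_solvable[OF solv p _ _ D DK K(1)] E by blast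
    have "m = v * u" using m(1) v u(1) subgroup_card_pos[of E] E by simp
    then have "p dvd u" using m(2) nv p by (simp add: prime_dvd_mult_iff)
    with u(2) obtain k where k: "u = p ^ k" by blast
    have comm: "x \<otimes> y \<otimes> inv x \<otimes> inv y \<in> E" if "x \<in> D" "y \<in> D" for x y
      using minimal_normal_over_abelian[OF p _ _ D DK K(1) _ that, of k] E u k by simp
    have cop: "coprime u v" unfolding k using nv p by (simp add: prime_imp_coprime coprime_power_left_iff)
    obtain L where L: "subgroup L G" "L \<subseteq> K" "card K = u * card L"
      using abelian_section_complement[OF _ D'(1) K(1) D'(3) DK _ D'(2) comm u(1) v cop] E by blast
    obtain l where "card M = p ^ l * card K" using K(3) by blast
    then have "card M = p ^ (l + k) * card L" using L(3) k by (simp add: power_add)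
    then have "card K \<le> card L" using least[of L] L K(2) by blast
    moreover have "u > 1"
    proof -
      have "p > 1" using p by (rule prime_gt_1_nat)
      moreover have "k \<noteq> 0" using \<open>p dvd u\<close> k p by (intro notI) simp
      ultimately show ?thesis unfolding k using one_less_power[of p k] by simp
    qed
    ultimately show False using L(3) subgroup_card_pos[OF L(1)] by simp
  qed
  with K that show thesis by blast
qed

end

section \<open>The Fitting subgroup\<close>

lemma (in group) lower_central_series_subset: "lower_central_series G n \<subseteq> carrier G"
proof (induction n)
  case (Suc n)
  show ?case unfolding lower_central_series.simps(2)
    by (rule generate_incl) (use Suc.IH in auto)
qed simp

lemma (in comm_group) nilpotent: "nilpotent_group G"
proof -
  have "h \<otimes> g \<otimes> inv h \<otimes> inv g = \<one>" if "h \<in> carrier G" "g \<in> carrier G" for h g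
    using that by (simp add: m_comm[of h g] group_word)
  then have "(\<Union>h\<in>carrier G. \<Union>g\<in>carrier G. {h \<otimes> g \<otimes> inv h \<otimes> inv g}) = {\<one>}"
    using one_closed by (auto 0 3)
  then have "lower_central_series G 1 = {\<one>}" by (simp add: generate_one)
  then show ?thesis unfolding nilpotent_group_def by blast
qed

text \<open>Take a term \<open>\<gamma>\<close> of the lower central series with \<open>\<gamma> \<nsubseteq> H\<close> whose successor lies in \<open>H\<close>. For
  \<open>x \<in> \<gamma>\<close> all commutators of \<open>x\<close> with elements of \<open>H\<close> are then in \<open>H\<close>.\<close>
lemma (in group) nilpotent_normalizer_grows:
  assumes nil: "nilpotent_group G" and H: "subgroup H G" "H \<noteq> carrier G"
  obtains x where "x \<in> carrier G" "x \<notin> H" "normalizes G {x} H"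
proof -
  note [simp] = subgroup.mem_carrier[OF H(1)]
  obtain n where n: "lower_central_series G n = {\<one>}" using nil by (auto simp: nilpotent_group_def)
  define i where "i = (LEAST i. lower_central_series G i \<subseteq> H)"
  have i: "lower_central_series G i \<subseteq> H"
    unfolding i_def by (rule LeastI[of _ n]) (use n subgroup.one_closed[OF H(1)] in simp)
  have "i \<noteq> 0" using i H subgroup.subset[OF H(1)] by (intro notI) auto
  then obtain j where j: "i = Suc j" by (cases i) auto
  then have "j < i" by simp
  then have "\<not> lower_central_series G j \<subseteq> H" using not_less_Least unfolding i_def by blast
  then obtain x where x: "x \<in> lower_central_series G j" "x \<notin> H" by blast
  have xc: "x \<in> carrier G" using x(1) lower_central_series_subset by blast
  have "x \<otimes> h \<otimes> inv x \<in> H" if h: "h \<in> H" for h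
  proof -
    have "x \<otimes> h \<otimes> inv x \<otimes> inv h \<in> lower_central_series G i"
      unfolding j lower_central_series.simps(2)
      by (rule generate.incl, rule UN_I[OF x(1)], rule UN_I[of h]) (use h in simp_all)
    then have "x \<otimes> h \<otimes> inv x \<otimes> inv h \<otimes> h \<in> H" using i h subgroup.m_closed[OF H(1)] by blast
    then show ?thesis using xc h by (simp add: group_word)
  qed
  then show thesis using that[OF xc x(2)] by (simp add: normalizes_def)
qed

context finite_group
begin

text \<open>The normalizer of a Sylow subgroup \<open>Q\<close> is self-normalizing, since \<open>Q\<close> is the only subgroup
  of its order in it. In a nilpotent group it is therefore the whole group.\<close>
lemma nilpotent_normal_sylow:
  assumes nil: "nilpotent_group G" and q: "Factorial_Ring.prime q"
  obtains Q a v where "subgroup Q G" "normalizes G (carrier G) Q"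
    "card Q = q ^ a" "order G = v * card Q" "\<not> q dvd v"
proof -
  have "order G \<noteq> 0" using order_gt_0_iff_finite finite_carrier by simp
  moreover have "\<not> is_unit q" using prime_gt_1_nat[OF q] by simp
  ultimately obtain a v where v: "order G = q ^ a * v" "\<not> q dvd v"
    using multiplicity_decompose' by blast
  obtain Q where Q: "subgroup Q G" "card Q = q ^ a"
    using sylow_thm[OF q is_group v(1) finite_carrier] by blast
  note [simp] = subgroup.mem_carrier[OF Q(1)]
  define P where "P = normalizer_set Q"
  have P: "subgroup P G" unfolding P_def by (rule subgroup_normalizer_set[OF Q(1)])
  have Pc: "P \<subseteq> carrier G" using subgroup.subset[OF P] .
  have PQ: "normalizes G P Q" using normalizes_iff_subset[OF Pc] P_def by simp
  have QP: "Q \<subseteq> P"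
    using normalizes_iff_subset[OF subgroup.subset[OF Q(1)], of Q] normalizes_self[OF Q(1)] P_def by simp
  obtain w where w: "card P = w * card Q"
    using subgroup_card_dvd[OF Q(1) P QP] by (metis dvd_def mult.commute)
  have "w dvd v"
  proof -
    obtain e where "order G = card P * e" using subgroup_card_dvd_order[OF P] by (blast elim: dvdE)
    then have "card Q * v = card Q * (w * e)" using v(1) Q(2) w by (simp add: ac_simps)
    then show ?thesis using subgroup_card_pos[OF Q(1)] by simp
  qed
  then have "\<not> q dvd w" using v(2) dvd_trans by blast
  then have cop: "coprime (card Q) w"
    unfolding Q(2) using q by (simp add: prime_imp_coprime coprime_power_left_iff)
  have "P = carrier G"
  proof (rule ccontr)
    assume "P \<noteq> carrier G"
    then obtain x where x: "x \<in> carrier G" "x \<notin> P" "normalizes G {x} P"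
      using nilpotent_normalizer_grows[OF nil P] by blast
    let ?A = "(\<lambda>h. x \<otimes> h \<otimes> inv x) ` Q"
    have A: "subgroup ?A G" by (rule subgroup_conj[OF Q(1) x(1)])
    have AP: "?A \<subseteq> P" using normalizesD[OF x(3)] QP by blast
    have "?A \<subseteq> Q"
      by (rule subset_of_coprime_index[OF A Q(1) P triv_subgroup AP QP _ _ _ _ w cop])
        (use subgroup.one_closed[OF A] subgroup.one_closed[OF Q(1)]
          subgroup_set_mult[OF A Q(1) normalizes_mono[OF PQ AP]]
          card_conj[OF subgroup.subset[OF Q(1)] x(1)] in simp_all)
    then have "x \<in> P" using x(1) by (auto simp: P_def normalizer_set_def normalizes_def)
    with x(2) show False by simp
  qed
  then show thesis using that[of Q a v] Q v PQ by (simp add: mult.commute)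
qed

lemma fitting_subgroup_prime_dvd:
  assumes q: "Factorial_Ring.prime q" and dvd: "q dvd card (fitting_subgroup G)"
  obtains S j where "S \<lhd> G" "card S = q ^ j" "j > 0"
proof -
  let ?\<N> = "{N. N \<lhd> G \<and> nilpotent_group (G\<lparr>carrier := N\<rparr>)}"
  have "\<exists>N\<in>?\<N>. q dvd card N"
  proof (rule ccontr)
    assume none: "\<not> ?thesis"
    \<comment> \<open>Then the largest normal subgroup of order prime to \<open>q\<close> contains the Fitting subgroup.\<close>
    let ?P = "\<lambda>N. N \<lhd> G \<and> \<not> q dvd card N"
    have "?P {\<one>}" using one_is_normal prime_gt_1_nat[OF q] by simp
    moreover have "\<forall>N. ?P N \<longrightarrow> card N < Suc (order G)"
      using card_mono[OF finite_carrier] subgroup.subset[OF normal_imp_subgroup]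
      by (auto simp: order_def less_Suc_eq_le)
    ultimately have "\<exists>N. ?P N \<and> (\<forall>N'. ?P N' \<longrightarrow> card N' \<le> card N)"
      by (rule Lattices_Big.ex_has_greatest_nat)
    then obtain N where N: "N \<lhd> G" "\<not> q dvd card N" and most: "\<And>N'. ?P N' \<Longrightarrow> card N' \<le> card N" by metis
    note Ns = normal_imp_subgroup[OF N(1)]
    have le: "N' \<subseteq> N" if N': "N' \<in> ?\<N>" for N'
    proof -
      have N'n: "N' \<lhd> G" and N's: "subgroup N' G" using N' normal_imp_subgroup by auto
      have prod: "N' <#> N \<lhd> G" by (rule normal_subgroup_set_mult_closed[OF N'n N(1)])
      have "card (N' <#> N) dvd card N' * card N" using card_set_mult[OF N's Ns] by (metis dvd_triv_left)
      moreover have "\<not> q dvd card N' * card N" using none N' N(2) q prime_dvd_mult_iff by blast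
      ultimately have "\<not> q dvd card (N' <#> N)" using dvd_trans by blast
      then have "card (N' <#> N) \<le> card N" using most prod by blast
      moreover have "N \<subseteq> N' <#> N" by (rule subset_set_mult2[OF N's subgroup.subset[OF Ns]])
      ultimately have "N = N' <#> N"
        by (intro card_seteq subgroup_finite[OF normal_imp_subgroup[OF prod]])
      then show ?thesis using subset_set_mult1[OF subgroup.subset[OF N's] Ns] by simp
    qed
    have "fitting_subgroup G \<subseteq> N"
      unfolding fitting_subgroup_def by (rule generate_subgroup_incl[OF _ Ns]) (use le in blast)
    moreover have "subgroup (fitting_subgroup G) G"
      unfolding fitting_subgroup_def
      by (rule generate_is_subgroup) (use le subgroup.subset[OF Ns] in blast)
    ultimately have "card (fitting_subgroup G) dvd card N" using subgroup_card_dvd Ns by blast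
    then show False using dvd N(2) dvd_trans by blast
  qed
  then obtain N where N: "N \<lhd> G" "nilpotent_group (G\<lparr>carrier := N\<rparr>)" "q dvd card N" by blast
  note Ns = normal_imp_subgroup[OF N(1)]
  interpret N: finite_group "G\<lparr>carrier := N\<rparr>" by (rule finite_group_subgroup[OF Ns])
  obtain Q a v where Q: "subgroup Q (G\<lparr>carrier := N\<rparr>)"
    "normalizes (G\<lparr>carrier := N\<rparr>) (carrier (G\<lparr>carrier := N\<rparr>)) Q"
    "card Q = q ^ a" "order (G\<lparr>carrier := N\<rparr>) = v * card Q" "\<not> q dvd v"
    using N.nilpotent_normal_sylow[OF N(2) q] .
  have cN: "card N = v * card Q" using Q(4) by (simp add: order_def)
  have QN: "Q \<subseteq> N" using subgroup.subset[OF Q(1)] by simp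
  have QG: "subgroup Q G" by (rule incl_subgroup[OF Ns Q(1)])
  have NQ: "normalizes G N Q" using Q(2) by (simp add: normalizes_def m_inv_consistent[OF Ns])
  have cop: "coprime (card Q) v"
    unfolding Q(3) using q Q(5) by (simp add: prime_imp_coprime coprime_power_left_iff)
  have "normalizes G {x} Q" if x: "x \<in> carrier G" for x
  proof -
    let ?A = "(\<lambda>h. x \<otimes> h \<otimes> inv x) ` Q"
    have A: "subgroup ?A G" by (rule subgroup_conj[OF QG x])
    have AN: "?A \<subseteq> N" using normal_invE(2)[OF N(1) x] QN by blast
    have "?A \<subseteq> Q"
      by (rule subset_of_coprime_index[OF A QG Ns triv_subgroup AN QN _ _ _ _ cN cop])
        (use subgroup.one_closed[OF A] subgroup.one_closed[OF QG]
          subgroup_set_mult[OF A QG normalizes_mono[OF NQ AN]]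
          card_conj[OF subgroup.subset[OF QG] x] in simp_all)
    then show ?thesis by (auto simp: normalizes_def)
  qed
  then have "Q \<lhd> G" using QG by (auto simp: normal_iff_normalizes normalizes_def)
  moreover have "a > 0" using N(3) Q(3,5) cN by (cases a) auto
  ultimately show thesis using that Q(3) by blast
qed

text \<open>The two facts needed about the Fitting subgroup of \<open>M / C\<close> in terms of subgroups of \<open>M\<close>.\<close>
lemma fitting_Mod_prime_dvd:
  assumes M: "subgroup M G" and C: "subgroup C G" and CM: "C \<subseteq> M" and norm: "normalizes G M C"
    and q: "Factorial_Ring.prime q" and dvd: "q dvd card (fitting_subgroup (G\<lparr>carrier := M\<rparr> Mod C))"
  obtains R j where "subgroup R G" "normalizes G M R" "C \<subseteq> R" "R \<subseteq> M" "card R = q ^ j * card C" "j > 0"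
proof -
  interpret M: finite_group "G\<lparr>carrier := M\<rparr>" by (rule finite_group_subgroup[OF M])
  have CM': "C \<lhd> G\<lparr>carrier := M\<rparr>" using normal_restrict_iff[OF M CM] C norm by simp
  interpret CM: normal C "G\<lparr>carrier := M\<rparr>" by (rule CM')
  interpret Q: finite_group "G\<lparr>carrier := M\<rparr> Mod C" by (rule M.finite_group_Mod[OF CM'])
  obtain S j where S: "S \<lhd> G\<lparr>carrier := M\<rparr> Mod C" "card S = q ^ j" "j > 0"
    using Q.fitting_subgroup_prime_dvd[OF q dvd] .
  note Ss = normal_imp_subgroup[OF S(1)]
  define R where "R = \<Union>S"
  have R: "R \<lhd> G\<lparr>carrier := M\<rparr>" unfolding R_def by (rule CM.factgroup_subgroup_union_normal[OF S(1)])
  have RM: "R \<subseteq> M" using subgroup.subset[OF normal_imp_subgroup[OF R]] by simp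
  have R': "subgroup R G" "normalizes G M R" using R normal_restrict_iff[OF M RM] by simp_all
  have "C \<in> S" using subgroup.one_closed[OF Ss] by simp
  then have CR: "C \<subseteq> R" by (auto simp: R_def)
  have "S = rcosets\<^bsub>G\<lparr>carrier := R\<rparr>\<^esub> C"
    using CM.factgroup_subgroup_union_factor[OF Ss] by (simp add: R_def)
  then have "card R = q ^ j * card C" using order_Mod[OF R'(1) C CR] S(2) by simp
  then show thesis using that R' CR RM S(3) by blast
qed

lemma fitting_Mod_trivial:
  assumes M: "subgroup M G" and C: "subgroup C G" and norm: "normalizes G M C"
    and triv: "fitting_subgroup (G\<lparr>carrier := M\<rparr> Mod C) = {C}"
    and R: "subgroup R G" "normalizes G M R" "C \<subseteq> R" "R \<subseteq> M"
    and comm: "\<And>x y. x \<in> R \<Longrightarrow> y \<in> R \<Longrightarrow> x \<otimes> y \<otimes> inv x \<otimes> inv y \<in> C"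
  shows "R = C"
proof -
  have CM: "C \<subseteq> M" using R by blast
  interpret M: finite_group "G\<lparr>carrier := M\<rparr>" by (rule finite_group_subgroup[OF M])
  have CM': "C \<lhd> G\<lparr>carrier := M\<rparr>" using normal_restrict_iff[OF M CM] C norm by simp
  have RM': "R \<lhd> G\<lparr>carrier := M\<rparr>" using normal_restrict_iff[OF M R(4)] R by simp
  define Q where "Q = G\<lparr>carrier := M\<rparr> Mod C"
  interpret Q: finite_group Q unfolding Q_def by (rule M.finite_group_Mod[OF CM'])
  define S where "S = rcosets\<^bsub>G\<lparr>carrier := R\<rparr>\<^esub> C"
  have S: "S \<lhd> Q" using M.normality_factorization[OF CM' R(3) RM'] by (simp add: S_def Q_def)
  have "comm_group (Q\<lparr>carrier := S\<rparr>)"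
  proof (rule group.group_comm_groupI[OF Q.subgroup_imp_group[OF normal_imp_subgroup[OF S]]])
    fix a b assume "a \<in> carrier (Q\<lparr>carrier := S\<rparr>)" "b \<in> carrier (Q\<lparr>carrier := S\<rparr>)"
    then obtain x y where xy: "x \<in> R" "a = C #> x" "y \<in> R" "b = C #> y"
      by (auto simp: S_def RCOSETS_def)
    then show "a \<otimes>\<^bsub>Q\<lparr>carrier := S\<rparr>\<^esub> b = b \<otimes>\<^bsub>Q\<lparr>carrier := S\<rparr>\<^esub> a"
      using cosets_commute[OF M CM' _ _ comm] R(4) by (simp add: Q_def subset_iff)
  qed
  then have "nilpotent_group (Q\<lparr>carrier := S\<rparr>)" by (rule comm_group.nilpotent)
  then have "S \<subseteq> fitting_subgroup Q"
    using S unfolding fitting_subgroup_def by (auto intro: generate.incl)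
  then have sub: "S \<subseteq> {C}" using triv by (simp add: Q_def)
  show "R = C"
  proof
    show "R \<subseteq> C"
    proof
      fix x assume x: "x \<in> R"
      then have "C #> x = C" using sub by (auto simp: S_def RCOSETS_def)
      then show "x \<in> C" using rcos_self[OF _ C, of x] subgroup.mem_carrier[OF R(1) x] by simp
    qed
  qed (rule R(3))
qed

end

section \<open>Maximal subgroups of prime power index\<close>

context group
begin

lemma mem_normal_core_iff:
  assumes M: "M \<subseteq> carrier G"
  shows "x \<in> normal_core G M \<longleftrightarrow> x \<in> carrier G \<and> (\<forall>g\<in>carrier G. g \<otimes> x \<otimes> inv g \<in> M)"
proof -
  have "x \<in> inv g <# M #> g \<longleftrightarrow> x \<in> carrier G \<and> g \<otimes> x \<otimes> inv g \<in> M" if g: "g \<in> carrier G" for g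
  proof
    assume "x \<in> inv g <# M #> g"
    then obtain m where m: "m \<in> M" "x = inv g \<otimes> m \<otimes> g" by (auto simp: l_coset_def r_coset_def)
    then have "m \<in> carrier G" using M by blast
    then show "x \<in> carrier G \<and> g \<otimes> x \<otimes> inv g \<in> M" using m g by (simp add: group_word)
  next
    assume x: "x \<in> carrier G \<and> g \<otimes> x \<otimes> inv g \<in> M"
    then have "x = inv g \<otimes> (g \<otimes> x \<otimes> inv g) \<otimes> g" using g by (simp add: group_word)
    with x show "x \<in> inv g <# M #> g" unfolding l_coset_def r_coset_def by blast
  qed
  then show ?thesis unfolding normal_core_def using one_closed by blast
qed

lemma normal_core_subset: "M \<subseteq> carrier G \<Longrightarrow> normal_core G M \<subseteq> M"
  using mem_normal_core_iff[of M] by (force dest: bspec[of _ _ \<one>])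

lemma normalizes_normal_core: "M \<subseteq> carrier G \<Longrightarrow> normalizes G (carrier G) (normal_core G M)"
proof -
  assume M: "M \<subseteq> carrier G"
  have "h \<otimes> (g \<otimes> x \<otimes> inv g) \<otimes> inv h \<in> M"
    if "x \<in> normal_core G M" "g \<in> carrier G" "h \<in> carrier G" for g h x
  proof -
    have "(h \<otimes> g) \<otimes> x \<otimes> inv (h \<otimes> g) \<in> M" and "x \<in> carrier G"
      using that mem_normal_core_iff[OF M] by auto
    then show ?thesis using that by (simp add: group_word)
  qed
  then show ?thesis using mem_normal_core_iff[OF M] by (auto simp: normalizes_def)
qed

lemma subset_normal_core:
  assumes "M \<subseteq> carrier G" "R \<subseteq> M" "normalizes G (carrier G) R"
  shows "R \<subseteq> normal_core G M"
  unfolding subset_iff mem_normal_core_iff[OF assms(1)] using assms by (auto simp: normalizes_def)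

lemma subgroup_normal_core:
  assumes M: "subgroup M G"
  shows "subgroup (normal_core G M) G"
proof (rule subgroupI)
  note [simp] = mem_normal_core_iff[OF subgroup.subset[OF M]]
  show "normal_core G M \<subseteq> carrier G" by auto
  have "\<one> \<in> normal_core G M" using subgroup.one_closed[OF M] by simp
  then show "normal_core G M \<noteq> {}" by blast
  fix x assume x: "x \<in> normal_core G M"
  have "g \<otimes> inv x \<otimes> inv g \<in> M" if g: "g \<in> carrier G" for g
  proof -
    have "g \<otimes> x \<otimes> inv g \<in> M" using x g by simp
    from subgroup.m_inv_closed[OF M this] show ?thesis using x g by (simp add: group_word)
  qed
  then show "inv x \<in> normal_core G M" using x by simp
  fix y assume y: "y \<in> normal_core G M"
  have "g \<otimes> (x \<otimes> y) \<otimes> inv g \<in> M" if g: "g \<in> carrier G" for g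
  proof -
    have "g \<otimes> x \<otimes> inv g \<in> M" "g \<otimes> y \<otimes> inv g \<in> M" using x y g by simp_all
    from subgroup.m_closed[OF M this] show ?thesis using x y g by (simp add: group_word)
  qed
  then show "x \<otimes> y \<in> normal_core G M" using x y by simp
qed

lemma mem_normalizerD:
  assumes K: "K \<subseteq> carrier G" and g: "g \<in> normalizer G K" and k: "k \<in> K"
  shows "g \<in> carrier G" "g \<otimes> k \<otimes> inv g \<in> K"
proof -
  show "g \<in> carrier G" using g by (simp add: normalizer_def stabilizer_def)
  have "g <# K #> inv g = K" using g K by (simp add: normalizer_def stabilizer_def)
  moreover have "g \<otimes> k \<otimes> inv g \<in> g <# K #> inv g" using k by (auto simp: l_coset_def r_coset_def)
  ultimately show "g \<otimes> k \<otimes> inv g \<in> K" by simp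
qed

end

lemma maximal_subgroupD:
  assumes "maximal_subgroup M G"
  shows "subgroup M G" "M \<noteq> carrier G"
    and "\<And>H. subgroup H G \<Longrightarrow> M \<subseteq> H \<Longrightarrow> H \<noteq> M \<Longrightarrow> H = carrier G"
  using assms by (auto simp: maximal_subgroup_def)

context finite_group
begin

text \<open>The normalizer of a normal subgroup of \<open>M\<close> contains the maximal subgroup \<open>M\<close>.\<close>
lemma maximal_subgroup_subset_core:
  assumes max: "maximal_subgroup M G" and R: "subgroup R G" "R \<subseteq> M" "normalizes G M R"
    and x: "x \<in> carrier G" "x \<notin> M" "normalizes G {x} R"
  shows "R \<subseteq> normal_core G M"
proof -
  note M = maximal_subgroupD[OF max]
  have Mc: "M \<subseteq> carrier G" using subgroup.subset[OF M(1)] .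
  have "M \<subseteq> normalizer_set R" using R(3) normalizes_iff_subset[OF Mc] by simp
  moreover have "x \<in> normalizer_set R" using x by (simp add: normalizer_set_def)
  ultimately have "normalizer_set R = carrier G"
    using M(3)[OF subgroup_normalizer_set[OF R(1)]] x(2) by blast
  then have "normalizes G (carrier G) R" using normalizes_iff_subset[of "carrier G" R] by simp
  then show ?thesis by (rule subset_normal_core[OF Mc R(2)])
qed

text \<open>Write \<open>g \<in> N\<^sub>G(K)\<close> as \<open>l m\<close> with \<open>l \<in> L\<close>, \<open>m \<in> M\<close>. As \<open>R\<close> is normal in \<open>M\<close> and contained in
  \<open>K C\<close>, conjugation by \<open>l\<close> takes \<open>R\<close> into \<open>K C \<subseteq> M\<close>. It moves \<open>r \<in> R\<close> by an element of
  \<open>L \<inter> M = C \<subseteq> R\<close> only, so \<open>l\<close> normalizes \<open>R\<close>. As \<open>R\<close> is not normal in \<open>G\<close>, \<open>l\<close> lies in \<open>M\<close>.\<close>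
lemma normalizer_subset_maximal:
  assumes max: "maximal_subgroup M G"
    and L: "subgroup L G" "normalizes G (carrier G) L" "L \<inter> M \<subseteq> normal_core G M" "L <#> M = carrier G"
    and R: "subgroup R G" "normalizes G M R" "R \<subseteq> M" "normal_core G M \<subseteq> R" "R \<noteq> normal_core G M"
    and K: "subgroup K G" "K \<subseteq> M" "R \<subseteq> K <#> normal_core G M"
  shows "normalizer G K \<subseteq> M"
proof
  fix g assume g: "g \<in> normalizer G K"
  note M = maximal_subgroupD[OF max]
  have Mc: "M \<subseteq> carrier G" using subgroup.subset[OF M(1)] .
  note Kg = mem_normalizerD[OF subgroup.subset[OF K(1)] g]
  note CM = normal_core_subset[OF Mc]
  note [simp] = subgroup.mem_carrier[OF M(1)] subgroup.mem_carrier[OF L(1)] subgroup.mem_carrier[OF R(1)]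
    subgroup.mem_carrier[OF K(1)]
  have gc: "g \<in> carrier G" using Kg(1) subgroup.one_closed[OF K(1)] by blast
  then have "g \<in> L <#> M" using L(4) by simp
  then obtain l m where lm: "l \<in> L" "m \<in> M" "g = l \<otimes> m" by (auto simp: set_mult_def)
  have "l \<otimes> r \<otimes> inv l \<in> R" if r: "r \<in> R" for r
  proof -
    have rM: "r \<in> M" using r R(3) by blast
    have "inv m \<otimes> r \<otimes> inv (inv m) \<in> R"
      using normalizesD[OF R(2) _ r] lm(2) subgroup.m_inv_closed[OF M(1)] by blast
    then obtain k c where kc: "k \<in> K" "c \<in> normal_core G M" "inv m \<otimes> r \<otimes> inv (inv m) = k \<otimes> c"
      using K(3) by (auto simp: set_mult_def)
    have cc: "c \<in> carrier G" using kc(2) CM Mc by blast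
    have "l \<otimes> r \<otimes> inv l = g \<otimes> (inv m \<otimes> r \<otimes> inv (inv m)) \<otimes> inv g"
      using lm r by (simp add: group_word)
    also have "\<dots> = (g \<otimes> k \<otimes> inv g) \<otimes> (g \<otimes> c \<otimes> inv g)"
      unfolding kc(3) using gc cc kc(1) by (simp add: group_word)
    finally have eq: "l \<otimes> r \<otimes> inv l = (g \<otimes> k \<otimes> inv g) \<otimes> (g \<otimes> c \<otimes> inv g)" .
    have "g \<otimes> k \<otimes> inv g \<in> M" using Kg(2)[OF kc(1)] K(2) by blast
    moreover have "g \<otimes> c \<otimes> inv g \<in> M"
      using normalizesD[OF normalizes_normal_core[OF Mc] gc kc(2)] CM by blast
    ultimately have 1: "l \<otimes> r \<otimes> inv l \<in> M" using eq subgroup.m_closed[OF M(1)] by simp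
    have "r \<otimes> inv l \<otimes> inv r \<in> L"
      using normalizesD[OF L(2), of r "inv l"] lm(1) r subgroup.m_inv_closed[OF L(1)] by simp
    then have "l \<otimes> (r \<otimes> inv l \<otimes> inv r) \<in> L" using lm(1) subgroup.m_closed[OF L(1)] by blast
    moreover have "l \<otimes> (r \<otimes> inv l \<otimes> inv r) = (l \<otimes> r \<otimes> inv l) \<otimes> inv r"
      using lm(1) r by (simp add: group_word)
    moreover have "(l \<otimes> r \<otimes> inv l) \<otimes> inv r \<in> M"
      using 1 rM subgroup.m_closed[OF M(1)] subgroup.m_inv_closed[OF M(1)] by blast
    ultimately have "(l \<otimes> r \<otimes> inv l) \<otimes> inv r \<in> R" using L(3) R(4) by auto
    then have "(l \<otimes> r \<otimes> inv l) \<otimes> inv r \<otimes> r \<in> R" using r subgroup.m_closed[OF R(1)] by blast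
    then show ?thesis using lm(1) r by (simp add: group_word)
  qed
  then have "normalizes G {l} R" by (simp add: normalizes_def)
  then have "l \<in> M" using maximal_subgroup_subset_core[OF max R(1,3,2), of l] lm(1) R(4,5) by auto
  then show "g \<in> M" using lm subgroup.m_closed[OF M(1)] by simp
qed

text \<open>Let \<open>C\<close> be the core of \<open>M\<close> and \<open>L / C\<close> a minimal normal subgroup of \<open>G / C\<close>. Its order is divisible by
  \<open>|G : M| = |L : L \<inter> M|\<close>, hence it is a \<open>p\<close>-group, and \<open>L \<inter> M\<close> is normal in \<open>G\<close> because
  normalizers grow in \<open>L / C\<close>.\<close>
lemma ex_normal_complement_modulo_core:
  assumes solv: "p_solvable p G" and p: "Factorial_Ring.prime p"
    and max: "maximal_subgroup M G" and nn: "\<not> M \<lhd> G" and ind: "subgroup_index G M = p ^ \<alpha>"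
  obtains L k where "subgroup L G" "normalizes G (carrier G) L" "normal_core G M \<subseteq> L"
    "L \<inter> M = normal_core G M" "L <#> M = carrier G" "card L = p ^ k * card (normal_core G M)"
proof -
  note M = maximal_subgroupD[OF max]
  have Mc: "M \<subseteq> carrier G" using subgroup.subset[OF M(1)] .
  define C where "C = normal_core G M"
  have C: "subgroup C G" and CM: "C \<subseteq> M" and Cn: "normalizes G (carrier G) C"
    using subgroup_normal_core[OF M(1)] normal_core_subset[OF Mc] normalizes_normal_core[OF Mc]
    by (simp_all add: C_def)
  have "C \<noteq> carrier G" using CM M(2) Mc by blast
  then obtain L where min: "minimal_normal_over G (carrier G) C L"
    using ex_minimal_normal_over[OF subgroup_self normalizes_self[OF subgroup_self]]
      subgroup.subset[OF C] by blast
  note L = minimal_normal_overD[OF min]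
  have Lc: "L \<subseteq> carrier G" using subgroup.subset[OF L(1)] .
  have LM: "\<not> L \<subseteq> M" using subset_normal_core[OF Mc _ L(2)] L(3,4) by (auto simp: C_def)
  have nL: "normalizes G M L" using normalizes_mono[OF L(2) Mc] .
  have "L <#> M = M <#> L"
    using commut_normal[OF M(1)] L(1,2) by (simp add: normal_iff_normalizes)
  moreover have "subgroup (M <#> L) G" by (rule subgroup_set_mult[OF M(1) L(1) nL])
  moreover have "M \<subseteq> M <#> L" "L \<subseteq> M <#> L"
    using subset_set_mult1[OF Mc L(1)] subset_set_mult2[OF M(1) Lc] by simp_all
  ultimately have LMG: "L <#> M = carrier G" using M(3)[of "M <#> L"] LM by auto
  have I: "subgroup (L \<inter> M) G" by (rule subgroups_Inter_pair[OF L(1) M(1)])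
  have "order G * card (L \<inter> M) = card L * card M"
    using card_set_mult[OF L(1) M(1)] LMG by (simp add: order_def)
  then have cL: "card L = p ^ \<alpha> * card (L \<inter> M)"
    using subgroup_index_mult[OF M(1)] ind subgroup_card_pos[OF M(1)] by simp
  have "\<alpha> \<noteq> 0"
  proof
    assume "\<alpha> = 0"
    then have "card M = card (carrier G)" using subgroup_index_mult[OF M(1)] ind by (simp add: order_def)
    then show False using M(2) card_subset_eq[OF finite_carrier Mc] by simp
  qed
  then obtain \<beta> where \<beta>: "\<alpha> = Suc \<beta>" by (cases \<alpha>) auto
  obtain m where m: "card L = m * card C" "(\<exists>k. m = p ^ k) \<or> \<not> p dvd m"
    using minimal_normal_over_p_solvable[OF solv p C Cn min Lc subgroup_self] .
  have CI: "C \<subseteq> L \<inter> M" using L(3) CM by blast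
  obtain i where i: "card (L \<inter> M) = card C * i"
    using subgroup_card_dvd[OF C I CI] by (blast elim: dvdE)
  have "m * card C = p ^ \<alpha> * (card C * i)" by (simp only: m(1)[symmetric] cL i)
  then have "card C * m = card C * (p ^ \<alpha> * i)" by (simp only: ac_simps)
  then have "m = p ^ \<alpha> * i" using subgroup_card_pos[OF C] by simp
  then have "p dvd m" by (simp add: \<beta>)
  then obtain k where k: "card L = p ^ k * card C" using m by blast
  have "L \<inter> M \<noteq> L" using LM by blast
  then obtain x where x: "x \<in> L" "x \<notin> L \<inter> M" "normalizes G {x} (L \<inter> M)"
    using normalizer_grows[OF p C I L(1) CI _ _ k normalizes_mono[OF Cn Lc]] by blast
  have "normalizes G M (L \<inter> M)" by (rule normalizes_Int[OF nL normalizes_self[OF M(1)]])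
  then have "L \<inter> M \<subseteq> C"
    using maximal_subgroup_subset_core[OF max I _ _ _ _ x(3)] x(1,2) Lc unfolding C_def by blast
  then have "L \<inter> M = C" using CI by blast
  then show thesis using that[of L k] L k LMG unfolding C_def by blast
qed

text \<open>With \<open>C\<close> the core of \<open>M\<close>, this says \<open>O\<^sub>p(M / C) = 1\<close>. The group \<open>R / C\<close> is a proper subgroup of the \<open>p\<close>-group
  \<open>R L / C\<close>, so an element of \<open>R L\<close> outside \<open>R\<close> normalizes \<open>R\<close>. It is not in \<open>M\<close>, because
  \<open>R L \<inter> M = R\<close>. Hence \<open>R\<close> is normal in \<open>G\<close> and contained in \<open>C\<close>.\<close>
lemma no_normal_p_section:
  assumes p: "Factorial_Ring.prime p" and max: "maximal_subgroup M G"
    and L: "subgroup L G" "normalizes G (carrier G) L" "normal_core G M \<subseteq> L"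
      "L \<inter> M = normal_core G M" "L <#> M = carrier G" "card L = p ^ k * card (normal_core G M)"
    and R: "subgroup R G" "normalizes G M R" "R \<subseteq> M" "normal_core G M \<subseteq> R"
      "card R = p ^ j * card (normal_core G M)"
  shows "R = normal_core G M"
proof -
  note M = maximal_subgroupD[OF max]
  have Mc: "M \<subseteq> carrier G" using subgroup.subset[OF M(1)] .
  define C where "C = normal_core G M"
  have C: "subgroup C G" and Cn: "normalizes G (carrier G) C"
    using subgroup_normal_core[OF M(1)] normalizes_normal_core[OF Mc] by (simp_all add: C_def)
  have Rc: "R \<subseteq> carrier G" and Lc: "L \<subseteq> carrier G" using R(1) L(1) by (simp_all add: subgroup.subset)
  have RL: "subgroup (R <#> L) G" by (rule subgroup_set_mult[OF R(1) L(1) normalizes_mono[OF L(2) Rc]])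
  have RLc: "R <#> L \<subseteq> carrier G" using subgroup.subset[OF RL] .
  have sub: "R \<subseteq> R <#> L" "L \<subseteq> R <#> L"
    using subset_set_mult1[OF Rc L(1)] subset_set_mult2[OF R(1) Lc] by simp_all
  have "R \<inter> L = C" using R(3,4) L(3,4) by (auto simp: C_def)
  then have "card (R <#> L) * card C = (p ^ (j + k) * card C) * card C"
    using card_set_mult[OF R(1) L(1)] R(5) L(6) by (simp add: C_def power_add ac_simps)
  then have card: "card (R <#> L) = p ^ (j + k) * card C" using subgroup_card_pos[OF C] by simp
  have "R \<noteq> R <#> L"
  proof
    assume "R = R <#> L"
    then have "L \<subseteq> M" using sub(2) R(3) by simp
    then have "L <#> M \<subseteq> M" by (intro set_mult_subset[OF M(1)]) simp_all
    then show False using L(5) M(2) Mc by simp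
  qed
  then obtain x where x: "x \<in> R <#> L" "x \<notin> R" "normalizes G {x} R"
    using normalizer_grows[OF p C R(1) RL _ sub(1) _ card normalizes_mono[OF Cn RLc]] R(4)
    unfolding C_def by blast
  have "x \<notin> M"
  proof
    assume xM: "x \<in> M"
    obtain r l where rl: "r \<in> R" "l \<in> L" "x = r \<otimes> l" using x(1) by (auto simp: set_mult_def)
    have "inv r \<otimes> x \<in> M"
      using rl(1) R(3) xM subgroup.m_closed[OF M(1)] subgroup.m_inv_closed[OF M(1)] by blast
    moreover have "inv r \<otimes> x = l"
      using rl subsetD[OF Rc rl(1)] subsetD[OF Lc rl(2)] by (simp add: group_word)
    ultimately have "l \<in> R" using rl(2) L(4) R(4) by blast
    then show False using x(2) rl subgroup.m_closed[OF R(1)] by blast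
  qed
  then have "R \<subseteq> C"
    using maximal_subgroup_subset_core[OF max R(1,3,2) _ _ x(3)] x(1) RLc by (auto simp: C_def)
  then show ?thesis using R(4) by (simp add: C_def)
qed

end

theorem theorem2:
  fixes G (structure) and M :: "'a set" and p \<alpha> :: nat
  assumes "group G" and "finite (carrier G)"
    and "Factorial_Ring.prime p"
    and "p_solvable p G"
    and "maximal_subgroup M G" and "\<not> M \<lhd> G"
    and "subgroup_index G M = p ^ \<alpha>"
  shows
    "(fitting_subgroup (G\<lparr>carrier := M\<rparr> Mod normal_core G M)
        \<noteq> {\<one>\<^bsub>G\<lparr>carrier := M\<rparr> Mod normal_core G M\<^esub>} \<longrightarrow>
      (\<forall>q \<in> prime_factors (card (fitting_subgroup (G\<lparr>carrier := M\<rparr> Mod normal_core G M))).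
        \<exists>Q. sylow_subgroup q Q G \<and> normalizer G Q \<subseteq> M)) \<and>
     (fitting_subgroup (G\<lparr>carrier := M\<rparr> Mod normal_core G M)
        = {\<one>\<^bsub>G\<lparr>carrier := M\<rparr> Mod normal_core G M\<^esub>} \<longrightarrow>
      (\<exists>K. hall_p'_subgroup p K G \<and> normalizer G K \<subseteq> M))"
proof -
  interpret finite_group G using assms(1,2) by (simp add: finite_group_def finite_group_axioms_def)
  note p = assms(3) and solv = assms(4) and max = assms(5)
  note M = maximal_subgroupD[OF max]
  have Mc: "M \<subseteq> carrier G" using subgroup.subset[OF M(1)] .
  define C where "C = normal_core G M"
  have C: "subgroup C G" and CM: "C \<subseteq> M" and Cn: "normalizes G (carrier G) C"
    using subgroup_normal_core[OF M(1)] normal_core_subset[OF Mc] normalizes_normal_core[OF Mc]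
    by (simp_all add: C_def)
  have CnM: "normalizes G M C" by (rule normalizes_mono[OF Cn Mc])
  have oG: "order G = p ^ \<alpha> * card M" using subgroup_index_mult[OF M(1)] assms(7) by simp
  obtain L k where L: "subgroup L G" "normalizes G (carrier G) L" "C \<subseteq> L" "L \<inter> M = C"
    "L <#> M = carrier G" "card L = p ^ k * card C"
    using ex_normal_complement_modulo_core[OF solv p max assms(6,7)] unfolding C_def .
  have key: "normalizer G K \<subseteq> M"
    if R: "subgroup R G" "normalizes G M R" "C \<subseteq> R" "R \<subseteq> M" "R \<noteq> C" "card R = u * card C"
      and K: "subgroup K G" "K \<subseteq> M" "card M = v * card K" and cop: "coprime u v" for R K u v
  proof -
    have KC: "subgroup (K <#> C) G"
      by (rule subgroup_set_mult[OF K(1) C normalizes_mono[OF CnM K(2)]])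
    have KCM: "K <#> C \<subseteq> M" by (rule set_mult_subset[OF M(1) K(2) CM])
    have sub: "K \<subseteq> K <#> C" "C \<subseteq> K <#> C"
      using subset_set_mult1[OF subgroup.subset[OF K(1)] C] subset_set_mult2[OF K(1) subgroup.subset[OF C]]
      by simp_all
    obtain w where w: "card M = card (K <#> C) * w"
      using subgroup_card_dvd[OF KC M(1) KCM] by (blast elim: dvdE)
    obtain e where e: "card (K <#> C) = card K * e"
      using subgroup_card_dvd[OF K(1) KC sub(1)] by (blast elim: dvdE)
    have "v * card K = (card K * e) * w" by (simp only: K(3)[symmetric] w e)
    then have "card K * v = card K * (e * w)" by (simp only: ac_simps)
    then have "v = e * w" using subgroup_card_pos[OF K(1)] by simp
    then have "coprime u w" using cop by simp
    moreover have "subgroup (R <#> (K <#> C)) G"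
    proof -
      have "subgroup (K <#> C <#> R) G"
        by (rule subgroup_set_mult[OF KC R(1) normalizes_mono[OF R(2) KCM]])
      moreover have "R <#> (K <#> C) = K <#> C <#> R"
        using commut_normal_subgroup[OF M(1) _ subgroup_incl[OF KC M(1) KCM]] R
          normal_restrict_iff[OF M(1) R(4)] by simp
      ultimately show ?thesis by simp
    qed
    ultimately have "R \<subseteq> K <#> C"
      using subset_of_coprime_index[OF R(1) KC M(1) C R(4) KCM R(3) sub(2) _ R(6)] w mult.commute
      by metis
    then show ?thesis
      using normalizer_subset_maximal[OF max L(1,2) _ L(5) R(1,2,4) _ _ K(1,2)] L(4) R(3,5)
      unfolding C_def by blast
  qed
  show ?thesis
    unfolding C_def[symmetric] one_FactGroup
  proof (intro conjI impI ballI)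
    fix q assume "q \<in> prime_factors (card (fitting_subgroup (G\<lparr>carrier := M\<rparr> Mod C)))"
    then have q: "Factorial_Ring.prime q" "q dvd card (fitting_subgroup (G\<lparr>carrier := M\<rparr> Mod C))"
      by (simp_all add: in_prime_factors_iff)
    obtain R j where R: "subgroup R G" "normalizes G M R" "C \<subseteq> R" "R \<subseteq> M" "card R = q ^ j * card C" "j > 0"
      using fitting_Mod_prime_dvd[OF M(1) C CM CnM q] .
    have "R \<noteq> C"
    proof
      assume "R = C"
      then have "q ^ j = 1" using R(5) subgroup_card_pos[OF C] by simp
      then show False using R(6) prime_gt_1_nat[OF q(1)] by simp
    qed
    then have "q \<noteq> p"
      using no_normal_p_section[OF p max L(1,2) _ _ L(5) _ R(1,2,4)] L(3,4,6) R(3,5)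
      unfolding C_def by blast
    have "card M \<noteq> 0" using subgroup_card_pos[OF M(1)] by simp
    moreover have "\<not> is_unit q" using prime_gt_1_nat[OF q(1)] by simp
    ultimately obtain a v where v: "card M = q ^ a * v" "\<not> q dvd v"
      using multiplicity_decompose' by blast
    interpret M: finite_group "G\<lparr>carrier := M\<rparr>" by (rule finite_group_subgroup[OF M(1)])
    obtain Q where Q: "subgroup Q (G\<lparr>carrier := M\<rparr>)" "card Q = q ^ a"
      using sylow_thm[OF q(1) M.is_group _ M.finite_carrier, of a v] v(1) by (auto simp: order_def)
    have QG: "subgroup Q G" and QM: "Q \<subseteq> M"
      using incl_subgroup[OF M(1) Q(1)] subgroup.subset[OF Q(1)] by simp_all
    have "\<not> q dvd p ^ \<alpha> * v"
      using v(2) q(1) primes_dvd_imp_eq[OF q(1) p] \<open>q \<noteq> p\<close>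
      by (auto simp: prime_dvd_mult_iff dest: prime_dvd_power)
    then have "multiplicity q (order G) = a"
      using oG v(1) prime_gt_0_nat[OF q(1)] by (intro multiplicity_eqI) (auto simp: ac_simps)
    then have sylow: "sylow_subgroup q Q G" using QG Q(2) by (simp add: sylow_subgroup_def)
    have "coprime (q ^ j) v"
      using q(1) v(2) by (simp add: prime_imp_coprime coprime_power_left_iff)
    moreover have "card M = v * card Q" using v(1) Q(2) by (simp add: mult.commute)
    ultimately have "normalizer G Q \<subseteq> M" using key[OF R(1-4) \<open>R \<noteq> C\<close> R(5) QG QM] by blast
    with sylow show "\<exists>Q. sylow_subgroup q Q G \<and> normalizer G Q \<subseteq> M" by blast
  next
    assume triv: "fitting_subgroup (G\<lparr>carrier := M\<rparr> Mod C) = {C}"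
    obtain K b where K: "subgroup K G" "K \<subseteq> M" "\<not> p dvd card K" "card M = p ^ b * card K"
      using ex_hall_p'_subgroup[OF solv p M(1)] .
    have "order G = p ^ (\<alpha> + b) * card K" using oG K(4) by (simp add: power_add)
    then have "subgroup_index G K * card K = p ^ (\<alpha> + b) * card K"
      using subgroup_index_mult[OF K(1)] by simp
    then have "subgroup_index G K = p ^ (\<alpha> + b)" using subgroup_card_pos[OF K(1)] by simp
    then have "hall_p'_subgroup p K G" using K by (auto simp: hall_p'_subgroup_def)
    moreover have "M \<noteq> C"
    proof
      assume "M = C"
      then have "M \<lhd> G" using C Cn by (simp add: normal_iff_normalizes)
      with assms(6) show False by simp
    qed
    then obtain R where min: "minimal_normal_over G M C R" and RM: "R \<subseteq> M"
      using ex_minimal_normal_over[OF M(1) normalizes_self[OF M(1)] CM] by blast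
    note R = minimal_normal_overD[OF min]
    obtain m where m: "card R = m * card C" "(\<exists>k. m = p ^ k) \<or> \<not> p dvd m"
      using minimal_normal_over_p_solvable[OF solv p C CnM min RM M(1)] .
    \<comment> \<open>An abelian normal subgroup \<open>R / C\<close> would lie in the Fitting subgroup.\<close>
    have "\<not> (\<exists>k. m = p ^ k)"
    proof
      assume "\<exists>k. m = p ^ k"
      then obtain k where "card R = p ^ k * card C" using m(1) by blast
      note comm = minimal_normal_over_abelian[OF p C CnM min RM M(1) this]
      have "R = C" using fitting_Mod_trivial[OF M(1) C CnM triv R(1-3) RM comm] .
      with R(4) show False by simp
    qed
    then have "\<not> p dvd m" using m(2) by blast
    then have "coprime p m" using p by (simp add: prime_imp_coprime)
    then have "coprime m (p ^ b)" by (simp add: coprime_power_right_iff coprime_commute)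
    then have "normalizer G K \<subseteq> M" using key[OF R(1-3) RM _ m(1) K(1,2,4)] R(4) by blast
    ultimately show "\<exists>K. hall_p'_subgroup p K G \<and> normalizer G K \<subseteq> M" by blast
  qed
qed

end
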